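(* Let $n\ge3$. Then $W_{A_{2n-1}^{(2)}}\cdot\varnothing=\mathcal C_{2n}^{s,p}$.
   Context: A $2n$-core is a partition having no hook length equal to $2n$; $\mathcal C_{2n}$ is the set of $2n$-cores and $\mathcal C_{2n}^{s,p}$ the subset of self-conjugate $2n$-cores with an even number of boxes on the main diagonal. The box in row $i$, column $j$ has residue $(j-i)\bmod 2n$; boxes of residue $i$ are $i$-nodes. The affine Weyl group $\widetilde{\mathfrak S}_{2n}$ of type $A_{2n-1}^{(1)}$, with simple reflections $s_0,\dots,s_{2n-1}$, acts on $\mathcal C_{2n}$: $s_i\cdot c$ is obtained by removing all removable $i$-nodes of $c$ if there are some, adding all addable $i$-nodes if there are some, and $s_i\cdot c=c$ otherwise. The affine Weyl group $W_{A_{2n-1}^{(2)}}$ of type $A_{2n-1}^{(2)}$ is realized as the subgroup of $\widetilde{\mathfrak S}_{2n}$ generated by $s_0s_1s_{2n-1}s_0$, $s_is_{2n-i}$ ($1\le i\le n-1$) and $s_n$. $\varnothing$ is the empty partition. *)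

theory Defs
  imports "HOL-Algebra.Generated_Groups" "HOL-Algebra.Group_Action"
begin

(* Partitions are identified with their Young diagrams: finite sets of boxes (i, j) closed
   under moving up and left.  Rows and columns are counted from 0, which changes neither
   residues nor hook lengths. *)

definition is_partition :: "(nat \<times> nat) set \<Rightarrow> bool" where
  "is_partition c \<longleftrightarrow>
     finite c \<and> (\<forall>i j i' j'. (i, j) \<in> c \<and> i' \<le> i \<and> j' \<le> j \<longrightarrow> (i', j') \<in> c)"

(* arm + leg + 1 *)
definition hook_length :: "(nat \<times> nat) set \<Rightarrow> nat \<times> nat \<Rightarrow> nat" where
  "hook_length c = (\<lambda>(i, j).
     card {j'. j < j' \<and> (i, j') \<in> c} + card {i'. i < i' \<and> (i', j) \<in> c} + 1)"

definition cores :: "nat \<Rightarrow> (nat \<times> nat) set set" where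
  "cores m = {c. is_partition c \<and> (\<forall>b\<in>c. hook_length c b \<noteq> m)}"

definition conjugate :: "(nat \<times> nat) set \<Rightarrow> (nat \<times> nat) set" where
  "conjugate c = {(i, j). (j, i) \<in> c}"

definition sc_even_cores :: "nat \<Rightarrow> (nat \<times> nat) set set" where
  "sc_even_cores m = {c \<in> cores m. conjugate c = c \<and> even (card {i. (i, i) \<in> c})}"

definition residue :: "nat \<Rightarrow> nat \<times> nat \<Rightarrow> int" where
  "residue m = (\<lambda>(i, j). (int j - int i) mod int m)"

definition removable_nodes :: "nat \<Rightarrow> nat \<Rightarrow> (nat \<times> nat) set \<Rightarrow> (nat \<times> nat) set" where
  "removable_nodes m k c = {b. b \<in> c \<and> is_partition (c - {b}) \<and> residue m b = int k}"

definition addable_nodes :: "nat \<Rightarrow> nat \<Rightarrow> (nat \<times> nat) set \<Rightarrow> (nat \<times> nat) set" where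
  "addable_nodes m k c = {b. b \<notin> c \<and> is_partition (insert b c) \<and> residue m b = int k}"

(* A core never has both removable and addable k-nodes, so the order of the tests is immaterial. *)
definition simple_act :: "nat \<Rightarrow> nat \<Rightarrow> (nat \<times> nat) set \<Rightarrow> (nat \<times> nat) set" where
  "simple_act m k c =
     (if removable_nodes m k c \<noteq> {} then c - removable_nodes m k c
      else if addable_nodes m k c \<noteq> {} then c \<union> addable_nodes m k c
      else c)"

(* The Coxeter group with generators s_i (i in I) and relations (s_i s_j)^(M i j) = 1, as the
   quotient of the words over I.  Inverses come for free since M i i = 1 makes each s_i an
   involution. *)

inductive coxeter_step :: "'i set \<Rightarrow> ('i \<Rightarrow> 'i \<Rightarrow> nat) \<Rightarrow> 'i list \<Rightarrow> 'i list \<Rightarrow> bool"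
  for I M where
  "i \<in> I \<Longrightarrow> j \<in> I \<Longrightarrow> coxeter_step I M (u @ concat (replicate (M i j) [i, j]) @ v) (u @ v)"

definition coxeter_rel :: "'i set \<Rightarrow> ('i \<Rightarrow> 'i \<Rightarrow> nat) \<Rightarrow> ('i list \<times> 'i list) set" where
  "coxeter_rel I M =
     {(u, v). u \<in> lists I \<and> v \<in> lists I \<and> equivclp (coxeter_step I M) u v}"

definition coxeter_group :: "'i set \<Rightarrow> ('i \<Rightarrow> 'i \<Rightarrow> nat) \<Rightarrow> 'i list set monoid" where
  "coxeter_group I M =
     \<lparr>carrier = lists I // coxeter_rel I M,
      mult = (\<lambda>A B. \<Union>u\<in>A. \<Union>v\<in>B. coxeter_rel I M `` {u @ v}),
      one = coxeter_rel I M `` {[]}\<rparr>"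

(* The Coxeter matrix of type A_(m-1)^(1), for m at least 3: the Dynkin diagram is an m-cycle. *)
definition affine_A_matrix :: "nat \<Rightarrow> nat \<Rightarrow> nat \<Rightarrow> nat" where
  "affine_A_matrix m i j =
     (if i = j then 1 else if j = (i + 1) mod m \<or> i = (j + 1) mod m then 3 else 2)"

definition affine_weyl_A :: "nat \<Rightarrow> nat list set monoid" where
  "affine_weyl_A m = coxeter_group {..<m} (affine_A_matrix m)"

definition simple_refl :: "nat \<Rightarrow> nat \<Rightarrow> nat list set" where
  "simple_refl m i = coxeter_rel {..<m} (affine_A_matrix m) `` {[i]}"

(* A group element is a class of words; it acts on a core by the common value of the left
   actions of its words (first letter applied last). *)
definition core_action :: "nat \<Rightarrow> nat list set \<Rightarrow> (nat \<times> nat) set \<Rightarrow> (nat \<times> nat) set" where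
  "core_action m A = (\<lambda>c\<in>cores m. THE d. \<forall>w\<in>A. foldr (simple_act m) w c = d)"

(* The affine Weyl group of type A_(2n-1)^(2) inside that of type A_(2n-1)^(1). *)
definition twisted_weyl_A :: "nat \<Rightarrow> nat list set set" where
  "twisted_weyl_A n =
     (let G = affine_weyl_A (2 * n); s = simple_refl (2 * n) in
      generate G
        ({s 0 \<otimes>\<^bsub>G\<^esub> s 1 \<otimes>\<^bsub>G\<^esub> s (2 * n - 1) \<otimes>\<^bsub>G\<^esub> s 0}
         \<union> {s i \<otimes>\<^bsub>G\<^esub> s (2 * n - i) | i. 1 \<le> i \<and> i \<le> n - 1}
         \<union> {s n}))"

end

theory Submission
  imports Defs
begin

text \<open>Record a partition \<open>c\<close> by its bead set, the integers \<open>(length of row i) - i\<close>; this is the Maya diagram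
read off its boundary, and it determines \<open>c\<close>. Three features of \<open>c\<close> become visible on the beads. Hook
lengths are the differences between a bead and a smaller non-bead, so \<open>c\<close> is an \<open>m\<close>-core iff its bead
set is closed under subtracting \<open>m\<close>. Conjugation is complementation composed with \<open>x \<mapsto> 1 - x\<close>. The
boxes on the main diagonal correspond to the positive beads. On the bead set of a core the simple
reflection \<open>s\<^sub>k\<close> exchanges \<open>x\<close> and \<open>x + 1\<close> for all \<open>x \<equiv> k\<close> modulo \<open>m\<close> (\<open>beads_simple_act\<close>). These are
permutations of the integers satisfying the Coxeter relations of affine type \<open>A\<close>, whence the action of the
affine Weyl group on cores is well defined (\<open>core_action_word_class\<close>), and the orbit of the empty
partition consists of the images of the empty partition under products of the given generators, each
of which is an involution (\<open>orbit_empty_eq\<close>).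

Let \<open>m = 2 n\<close>. Every generator of the twisted group is a permutation of the integers that commutes with
\<open>x \<mapsto> 1 - x\<close>, so it preserves self-conjugacy. All generators except \<open>s\<^sub>0 s\<^sub>1 s\<^bsub>2n-1\<^esub> s\<^sub>0\<close> preserve the
positive integers and hence the number of positive beads; the exceptional one exchanges \<open>{-1, 0}\<close> with
\<open>{1, 2}\<close> and does not cross the origin elsewhere, and on a self-conjugate bead set it replaces the number
of beads in \<open>{1, 2}\<close> by two minus that number. So the parity is preserved too
(\<open>word_act_sc_even_core\<close>), and the orbit is contained in the claimed set.

For the converse, a \<open>2n\<close>-core is determined by how far the beads reach in each residue class, the
charge \<open>N\<close>. A self-conjugate core has \<open>N (1 - x) = 1 - N x\<close>, so the vector \<open>a = (N 1, ..., N n)\<close>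
suffices. On it the generators act as the affine reflections that exchange \<open>a\<^sub>i\<close> and \<open>a\<^bsub>i+1\<^esub>\<close>, negate
\<open>a\<^sub>n\<close>, or send \<open>(a\<^sub>1, a\<^sub>2)\<close> to \<open>(1 - a\<^sub>2, 1 - a\<^sub>1)\<close>. A quadratic function of \<open>a\<close>, namely the number of
boxes of the core, drops under such a reflection exactly when \<open>a\<close> lies strictly on the wrong side of
its wall. If no generator makes it drop, then \<open>a\<^sub>1 \<ge> ... \<ge> a\<^sub>n \<ge> 0\<close> and \<open>a\<^sub>1 + a\<^sub>2 \<le> 1\<close>, which leaves only
\<open>a = 0\<close>, the empty core, and \<open>a = (1, 0, ..., 0)\<close>, the one-box core, whose diagonal is odd. Induction on
the size therefore connects every self-conjugate core with even diagonal to the empty one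
(\<open>sc_even_core_reachable\<close>).\<close>

section \<open>Bead sets of partitions\<close>

definition row_len :: "(nat \<times> nat) set \<Rightarrow> nat \<Rightarrow> nat" where
  "row_len c i = card {j. (i, j) \<in> c}"

definition col_len :: "(nat \<times> nat) set \<Rightarrow> nat \<Rightarrow> nat" where
  "col_len c j = card {i. (i, j) \<in> c}"

definition bead :: "(nat \<times> nat) set \<Rightarrow> nat \<Rightarrow> int" where
  "bead c i = int (row_len c i) - int i"

text \<open>The positions that are not beads, indexed by the columns; see \<open>compl_beads\<close>.\<close>

definition gap :: "(nat \<times> nat) set \<Rightarrow> nat \<Rightarrow> int" where
  "gap c j = int j + 1 - int (col_len c j)"

definition beads :: "(nat \<times> nat) set \<Rightarrow> int set" where
  "beads c = range (bead c)"

lemma downclosed_eq_lessThan_card: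
  fixes S :: "nat set"
  assumes "finite S" "\<And>a b. a \<in> S \<Longrightarrow> b \<le> a \<Longrightarrow> b \<in> S"
  shows "S = {..<card S}"
proof (cases "S = {}")
  case False
  with assms have "S = {..Max S}"
    using assms(2)[OF Max_in[OF assms(1) False]] by (auto intro: Max_ge)
  then show ?thesis
    by (metis card_atMost lessThan_Suc_atMost)
qed simp

lemma partition_finite: "is_partition c \<Longrightarrow> finite c"
  by (simp add: is_partition_def)

lemma partition_downclosed:
  "is_partition c \<Longrightarrow> (i, j) \<in> c \<Longrightarrow> i' \<le> i \<Longrightarrow> j' \<le> j \<Longrightarrow> (i', j') \<in> c"
  unfolding is_partition_def by blast

lemma finite_row: "finite c \<Longrightarrow> finite {j. (i, j) \<in> c}"
  by (rule finite_subset[of _ "snd ` c"]) (auto simp: rev_image_eqI)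

lemma finite_col: "finite c \<Longrightarrow> finite {i. (i, j) \<in> c}"
  by (rule finite_subset[of _ "fst ` c"]) (auto simp: rev_image_eqI)

lemma mem_iff_row_len:
  assumes "is_partition c"
  shows "(i, j) \<in> c \<longleftrightarrow> j < row_len c i"
proof -
  have "{j. (i, j) \<in> c} = {..<row_len c i}"
    unfolding row_len_def
    using assms by (intro downclosed_eq_lessThan_card)
      (auto simp: is_partition_def intro: finite_row)
  then show ?thesis by auto
qed

lemma mem_iff_col_len:
  assumes "is_partition c"
  shows "(i, j) \<in> c \<longleftrightarrow> i < col_len c j"
proof -
  have "{i. (i, j) \<in> c} = {..<col_len c j}"
    unfolding col_len_def
    using assms by (intro downclosed_eq_lessThan_card)
      (auto simp: is_partition_def intro: finite_col)
  then show ?thesis by auto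
qed

lemma row_len_antimono:
  assumes "is_partition c" "i \<le> i'"
  shows "row_len c i' \<le> row_len c i"
  by (metis assms mem_iff_row_len partition_downclosed not_le order_refl)

lemma bead_strict_antimono:
  assumes "is_partition c" "i < i'"
  shows "bead c i' < bead c i"
  using row_len_antimono[of c i i'] assms by (simp add: bead_def)

lemma bead_less_iff: "is_partition c \<Longrightarrow> bead c i' < bead c i \<longleftrightarrow> i < i'"
  by (metis bead_strict_antimono linorder_neqE_nat order_less_asym)

lemma inj_bead: "is_partition c \<Longrightarrow> inj (bead c)"
  by (metis bead_less_iff injI linorder_neqE_nat order_less_irrefl)

lemma gap_less_bead_iff:
  assumes "is_partition c"
  shows "gap c j < bead c i \<longleftrightarrow> (i, j) \<in> c"
proof (cases "(i, j) \<in> c")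
  case True
  then have "j < row_len c i" "i < col_len c j"
    using assms mem_iff_row_len mem_iff_col_len by blast+
  then show ?thesis using True by (simp add: bead_def gap_def)
next
  case False
  then have "\<not> j < row_len c i" "\<not> i < col_len c j"
    using assms mem_iff_row_len mem_iff_col_len by blast+
  then show ?thesis using False by (simp add: bead_def gap_def)
qed

lemma gap_neq_bead:
  assumes "is_partition c"
  shows "gap c j \<noteq> bead c i"
proof (cases "(i, j) \<in> c")
  case False
  then have "\<not> j < row_len c i" "\<not> i < col_len c j"
    using assms mem_iff_row_len mem_iff_col_len by blast+
  then show ?thesis by (simp add: bead_def gap_def)
next
  case True
  then show ?thesis using gap_less_bead_iff[OF assms, of j i] by simp
qed

lemma finite_rows_nonempty: "finite c \<Longrightarrow> \<exists>L. \<forall>i\<ge>L. row_len c i = 0"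
proof -
  assume "finite c"
  then have "finite (fst ` c)" by simp
  then obtain L where "\<forall>i\<in>fst ` c. i < L" using finite_nat_set_iff_bounded by auto
  then have "{j. (i, j) \<in> c} = {}" if "i \<ge> L" for i using that by force
  then have "\<forall>i\<ge>L. row_len c i = 0" by (simp add: row_len_def)
  then show ?thesis ..
qed

text \<open>Beads are the vertical and gaps the horizontal steps of the boundary path of the diagram, and the
path takes exactly one step at each position. If \<open>z\<close> is not a bead, the first row whose bead lies
below \<open>z\<close> determines the column whose bottom edge is the step at \<open>z\<close>.\<close>

lemma compl_beads:
  assumes "is_partition c"
  shows "- beads c = range (gap c)"
proof
  show "range (gap c) \<subseteq> - beads c"
    using gap_neq_bead[OF assms] by (auto simp: beads_def)
  show "- beads c \<subseteq> range (gap c)"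
  proof
    fix z assume z: "z \<in> - beads c"
    obtain L where L: "\<forall>i\<ge>L. row_len c i = 0"
      using finite_rows_nonempty[OF partition_finite[OF assms]] by blast
    define i where "i = (LEAST i. bead c i \<le> z)"
    have "bead c (L + nat (- z)) \<le> z" using L by (simp add: bead_def)
    then have i: "bead c i \<le> z" unfolding i_def by (rule LeastI)
    have "bead c i \<noteq> z" using z by (auto simp: beads_def)
    with i have lt: "bead c i < z" by simp
    \<comment> \<open>Column \<open>j\<close> meets rows \<open>0, ..., i - 1\<close> only, and then \<open>gap c j = j + 1 - i\<close>.\<close>
    define j where "j = nat (z + int i - 1)"
    have j: "int j = z + int i - 1" using lt by (simp add: j_def bead_def)
    have "(i, j) \<notin> c" using j lt assms by (simp add: mem_iff_row_len bead_def)
    then have 1: "col_len c j \<le> i" using assms mem_iff_col_len by (metis not_le)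
    have 2: "i \<le> col_len c j"
    proof (cases i)
      case (Suc i')
      then have "\<not> bead c i' \<le> z" unfolding i_def by (metis not_less_Least lessI)
      then have "(i', j) \<in> c" using j Suc assms by (simp add: mem_iff_row_len bead_def)
      then show ?thesis using Suc assms mem_iff_col_len by auto
    qed simp
    have "gap c j = z" using 1 2 j by (simp add: gap_def)
    then show "z \<in> range (gap c)" by auto
  qed
qed

text \<open>The index of a bead is recovered from the bead set as the number of larger beads.\<close>

lemma bead_card_above:
  assumes "is_partition c"
  shows "card {x \<in> beads c. bead c i < x} = i"
proof -
  have "{x \<in> beads c. bead c i < x} = bead c ` {..<i}"
    using bead_less_iff[OF assms] by (auto simp: beads_def)
  then show ?thesis
    by (simp add: card_image inj_on_subset[OF inj_bead[OF assms]])
qed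

lemma beads_inject:
  assumes "is_partition c" "is_partition d" "beads c = beads d"
  shows "c = d"
proof -
  have "bead c i = bead d i" for i
  proof -
    have "bead c i \<in> beads d" using assms(3) by (auto simp: beads_def)
    then obtain i' where i': "bead c i = bead d i'" by (auto simp: beads_def)
    then show ?thesis
      using bead_card_above[OF assms(1), of i] bead_card_above[OF assms(2), of i'] assms(3)
      by simp
  qed
  then have "row_len c i = row_len d i" for i by (simp add: bead_def)
  then show ?thesis using assms mem_iff_row_len by auto
qed

lemma hook_length_eq:
  assumes c: "is_partition c" and ij: "(i, j) \<in> c"
  shows "int (hook_length c (i, j)) = bead c i - gap c j"
proof -
  have "{j'. j < j' \<and> (i, j') \<in> c} = {j<..<row_len c i}"
    "{i'. i < i' \<and> (i', j) \<in> c} = {i<..<col_len c j}"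
    using c by (auto simp: mem_iff_row_len) (auto simp: mem_iff_row_len[symmetric] mem_iff_col_len)
  moreover have "j < row_len c i" "i < col_len c j"
    using c ij mem_iff_row_len mem_iff_col_len by auto
  ultimately show ?thesis
    by (simp add: hook_length_def bead_def gap_def)
qed

text \<open>By \<open>hook_length_eq\<close> a box of hook length \<open>m\<close> gives a bead \<open>x\<close> for which \<open>x - m\<close> is a gap; conversely it exists
because a gap smaller than a bead always belongs to a box of the diagram.\<close>

lemma cores_iff:
  assumes "m > 0"
  shows "c \<in> cores m \<longleftrightarrow> is_partition c \<and> (\<forall>x\<in>beads c. x - int m \<in> beads c)"
proof (cases "is_partition c")
  case c: True
  have "(\<exists>b\<in>c. hook_length c b = m) \<longleftrightarrow> (\<exists>x\<in>beads c. x - int m \<notin> beads c)"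
  proof
    assume "\<exists>b\<in>c. hook_length c b = m"
    then obtain i j where ij: "(i, j) \<in> c" "hook_length c (i, j) = m" by auto
    then have "bead c i - int m = gap c j" using hook_length_eq[OF c ij(1)] by simp
    then have "bead c i - int m \<notin> beads c" using compl_beads[OF c] by auto
    then show "\<exists>x\<in>beads c. x - int m \<notin> beads c" by (auto simp: beads_def)
  next
    assume "\<exists>x\<in>beads c. x - int m \<notin> beads c"
    then obtain i where "bead c i - int m \<notin> beads c" by (auto simp: beads_def)
    then obtain j where j: "bead c i - int m = gap c j" using compl_beads[OF c] by auto
    then have ij: "(i, j) \<in> c" using gap_less_bead_iff[OF c, of j i] assms by simp
    then have "hook_length c (i, j) = m" using hook_length_eq[OF c ij] j by simp
    then show "\<exists>b\<in>c. hook_length c b = m" using ij by blast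
  qed
  then show ?thesis using c by (auto simp: cores_def)
qed (simp add: cores_def)

lemma partition_empty: "is_partition {}"
  by (simp add: is_partition_def)

lemma beads_empty: "beads {} = {..0}"
proof -
  have "bead {} = (\<lambda>i. - int i)" by (auto simp: bead_def row_len_def)
  moreover have "x \<in> range (\<lambda>i. - int i)" if "x \<le> 0" for x
    using that by (auto intro!: image_eqI[of _ _ "nat (- x)"])
  ultimately show ?thesis by (auto simp: beads_def)
qed

lemma beads_bounded:
  assumes "is_partition c"
  obtains L U where "\<And>z. z \<le> L \<Longrightarrow> z \<in> beads c" "\<And>z. U < z \<Longrightarrow> z \<notin> beads c"
proof -
  obtain L where L: "\<forall>i\<ge>L. row_len c i = 0"
    using finite_rows_nonempty[OF partition_finite[OF assms]] by blast
  have "z \<in> beads c" if "z \<le> - int L" for z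
  proof -
    have "bead c (nat (- z)) = z" using that L by (simp add: bead_def)
    then show ?thesis unfolding beads_def by (metis rangeI)
  qed
  moreover have "z \<notin> beads c" if "bead c 0 < z" for z
    using that bead_less_iff[OF assms, of 0] by (auto simp: beads_def)
  ultimately show ?thesis using that by blast
qed

subsection \<open>Conjugation and the main diagonal\<close>

lemma partition_conjugate:
  assumes "is_partition c"
  shows "is_partition (conjugate c)"
proof -
  have "conjugate c = c\<inverse>" by (auto simp only: conjugate_def converse_def)
  then have "finite (conjugate c)" using assms by (simp add: partition_finite)
  moreover have "(i', j') \<in> conjugate c" if "(i, j) \<in> conjugate c" "i' \<le> i" "j' \<le> j" for i j i' j'
    using that partition_downclosed[OF assms] by (simp add: conjugate_def)
  ultimately show ?thesis unfolding is_partition_def by blast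
qed

lemma mem_beads_conjugate:
  assumes "is_partition c"
  shows "x \<in> beads (conjugate c) \<longleftrightarrow> 1 - x \<notin> beads c"
proof -
  have b: "bead (conjugate c) j = 1 - gap c j" for j
    by (simp add: bead_def gap_def row_len_def col_len_def conjugate_def)
  have "x = 1 - gap c j \<longleftrightarrow> 1 - x = gap c j" for j by auto
  then have "x \<in> beads (conjugate c) \<longleftrightarrow> 1 - x \<in> range (gap c)"
    unfolding beads_def image_iff b by simp
  then show ?thesis using compl_beads[OF assms] by blast
qed

lemma self_conjugate_iff:
  assumes "is_partition c"
  shows "conjugate c = c \<longleftrightarrow> (\<forall>x. x \<in> beads c \<longleftrightarrow> 1 - x \<notin> beads c)"
proof
  show "conjugate c = c" if "\<forall>x. x \<in> beads c \<longleftrightarrow> 1 - x \<notin> beads c"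
  proof (rule beads_inject[OF partition_conjugate[OF assms] assms])
    show "beads (conjugate c) = beads c"
    proof (rule Set.set_eqI)
      show "x \<in> beads (conjugate c) \<longleftrightarrow> x \<in> beads c" for x
        using mem_beads_conjugate[OF assms, of x] that[rule_format, of x] by argo
    qed
  qed
  show "\<forall>x. x \<in> beads c \<longleftrightarrow> 1 - x \<notin> beads c" if "conjugate c = c"
    using mem_beads_conjugate[OF assms, unfolded that] ..
qed

lemma card_diagonal:
  assumes "is_partition c"
  shows "card {i. (i, i) \<in> c} = card {x \<in> beads c. 0 < x}"
proof -
  have "{x \<in> beads c. 0 < x} = bead c ` {i. (i, i) \<in> c}"
    using assms by (auto simp: beads_def mem_iff_row_len bead_def)
  then show ?thesis by (simp add: card_image inj_on_subset[OF inj_bead[OF assms]])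
qed

section \<open>Simple reflections act by exchanging adjacent bead positions\<close>

text \<open>The permutation of the integers by which the simple reflection of index \<open>k\<close> acts on beads: all
pairs \<open>x, x + 1\<close> with \<open>x \<equiv> k\<close> modulo \<open>m\<close> are exchanged. The index is an integer, so that negative
indices may stand for their residues.\<close>

definition adj_swap :: "int \<Rightarrow> int \<Rightarrow> int \<Rightarrow> int" where
  "adj_swap m k x = (if m dvd x - k then x + 1 else if m dvd x - k - 1 then x - 1 else x)"

text \<open>Used to tell residue classes apart: distinct numbers closer than the modulus are not both multiples of it.\<close>

lemma not_dvd_near:
  fixes m a b :: int
  assumes "m dvd a" "a \<noteq> b" "\<bar>a - b\<bar> < m"
  shows "\<not> m dvd b"
proof
  assume "m dvd b"
  with assms(1) have "m dvd a - b" by simp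
  then show False using assms(2,3) dvd_imp_le_int[of "a - b" m] by auto
qed

lemma adj_swap_up: "m dvd x - k \<Longrightarrow> adj_swap m k x = x + 1"
  by (simp add: adj_swap_def)

lemma adj_swap_down:
  assumes "m \<ge> 2" "m dvd x - k - 1"
  shows "adj_swap m k x = x - 1"
  using not_dvd_near[OF assms(2), of "x - k"] assms by (simp add: adj_swap_def)

lemma adj_swap_fix: "\<not> m dvd x - k \<Longrightarrow> \<not> m dvd x - k - 1 \<Longrightarrow> adj_swap m k x = x"
  by (simp add: adj_swap_def)

lemma adj_swap_invol:
  assumes "m \<ge> 2"
  shows "adj_swap m k (adj_swap m k x) = x"
proof -
  consider "m dvd x - k" | "m dvd x - k - 1" | "\<not> m dvd x - k" "\<not> m dvd x - k - 1" by blast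
  then show ?thesis
  proof cases
    case 1
    then show ?thesis using assms by (simp add: adj_swap_up adj_swap_down)
  next
    case 2
    then have "m dvd x - 1 - k" by (simp add: algebra_simps)
    then show ?thesis using assms 2 by (simp add: adj_swap_up adj_swap_down)
  next
    case 3
    then show ?thesis by (simp add: adj_swap_fix)
  qed
qed

lemma adj_swap_shift: "m dvd d \<Longrightarrow> adj_swap m k (x + d) = adj_swap m k x + d"
proof -
  assume d: "m dvd d"
  have "x + d - k = x - k + d" "x + d - k - 1 = x - k - 1 + d" by simp_all
  with d have "m dvd x + d - k \<longleftrightarrow> m dvd x - k" "m dvd x + d - k - 1 \<longleftrightarrow> m dvd x - k - 1"
    by (metis dvd_add_left_iff)+
  then show ?thesis by (simp add: adj_swap_def)
qed

lemma removable_node_iff: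
  assumes c: "is_partition c" and ij: "(i, j) \<in> c"
  shows "is_partition (c - {(i, j)}) \<longleftrightarrow> row_len c i = Suc j \<and> col_len c j = Suc i"
proof -
  have "is_partition (c - {(i, j)}) \<longleftrightarrow> (i, Suc j) \<notin> c \<and> (Suc i, j) \<notin> c"
  proof
    assume p: "is_partition (c - {(i, j)})"
    show "(i, Suc j) \<notin> c \<and> (Suc i, j) \<notin> c"
      using partition_downclosed[OF p, of i "Suc j" i j]
        partition_downclosed[OF p, of "Suc i" j i j] by auto
  next
    assume a: "(i, Suc j) \<notin> c \<and> (Suc i, j) \<notin> c"
    have "(a', b') \<noteq> (i, j)" if "(a, b) \<in> c - {(i, j)}" "a' \<le> a" "b' \<le> b" for a b a' b'
    proof
      assume eq: "(a', b') = (i, j)"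
      with that have "i < a \<or> j < b" by auto
      then show False
        using a partition_downclosed[OF c, of a b i "Suc j"] that
          partition_downclosed[OF c, of a b "Suc i" j] eq by auto
    qed
    then show "is_partition (c - {(i, j)})"
      using partition_finite[OF c] partition_downclosed[OF c]
      unfolding is_partition_def by (metis Diff_iff finite_Diff insert_iff empty_iff)
  qed
  moreover have "j < row_len c i" "i < col_len c j"
    using ij c mem_iff_row_len mem_iff_col_len by auto
  moreover have "(i, Suc j) \<notin> c \<longleftrightarrow> row_len c i \<le> Suc j" "(Suc i, j) \<notin> c \<longleftrightarrow> col_len c j \<le> Suc i"
    using mem_iff_row_len[OF c, of i "Suc j"] mem_iff_col_len[OF c, of "Suc i" j] by auto
  ultimately show ?thesis by auto
qed

lemma addable_node_iff:
  assumes c: "is_partition c" and ij: "(i, j) \<notin> c"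
  shows "is_partition (insert (i, j) c) \<longleftrightarrow> row_len c i = j \<and> col_len c j = i"
proof -
  have "is_partition (insert (i, j) c) \<longleftrightarrow> (\<forall>b<j. (i, b) \<in> c) \<and> (\<forall>a<i. (a, j) \<in> c)"
  proof
    assume p: "is_partition (insert (i, j) c)"
    have "(i, b) \<in> c" if "b < j" for b
      using partition_downclosed[OF p, of i j i b] that by auto
    moreover have "(a, j) \<in> c" if "a < i" for a
      using partition_downclosed[OF p, of i j a j] that by auto
    ultimately show "(\<forall>b<j. (i, b) \<in> c) \<and> (\<forall>a<i. (a, j) \<in> c)" by blast
  next
    assume r: "(\<forall>b<j. (i, b) \<in> c) \<and> (\<forall>a<i. (a, j) \<in> c)"
    have "(a', b') \<in> insert (i, j) c"
      if "(a, b) \<in> insert (i, j) c" "a' \<le> a" "b' \<le> b" for a b a' b'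
    proof (cases "(a, b) \<in> c")
      case True
      then show ?thesis using partition_downclosed[OF c] that by blast
    next
      case False
      then have "a' \<le> i" "b' \<le> j" using that by auto
      then consider "a' = i" "b' = j" | "a' < i" "b' \<le> j" | "a' \<le> i" "b' < j"
        by (auto simp: le_less)
      then show ?thesis
      proof cases
        case 2
        then show ?thesis using r partition_downclosed[OF c, of a' j a' b'] by simp
      next
        case 3
        then show ?thesis using r partition_downclosed[OF c, of i b' a' b'] by simp
      qed simp
    qed
    then show "is_partition (insert (i, j) c)"
      using partition_finite[OF c] unfolding is_partition_def by (metis finite_insert)
  qed
  also have "\<dots> \<longleftrightarrow> j \<le> row_len c i \<and> i \<le> col_len c j"
    using mem_iff_row_len[OF c] mem_iff_col_len[OF c] by (meson leD leI less_le_trans order_refl)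
  finally show ?thesis
    using ij mem_iff_row_len[OF c, of i j] mem_iff_col_len[OF c, of i j] by auto
qed

lemma residue_eq_iff:
  assumes "k < m"
  shows "residue m (i, j) = int k \<longleftrightarrow> int m dvd int j - int i - int k"
proof -
  have "int k mod int m = int k" using assms by simp
  then show ?thesis
    unfolding residue_def using mod_eq_dvd_iff[of "int j - int i" "int m" "int k"] by simp
qed

text \<open>A row of a partition ends in a removable node iff its bead can be moved one step down to a free
position. The free position is a gap, so it names the column, and comparing lengths shows that the
row and the column end in the same box. The addable nodes below are the mirror image.\<close>

lemma mem_removable_iff:
  assumes c: "is_partition c" and "k < m"
  shows "(i, j) \<in> removable_nodes m k c \<longleftrightarrow>
    int j = bead c i - 1 + int i \<and> bead c i - 1 \<notin> beads c \<and> int m dvd bead c i - 1 - int k"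
    (is "?L \<longleftrightarrow> ?R")
proof
  assume ?L
  then have ij: "(i, j) \<in> c" "row_len c i = Suc j" "col_len c j = Suc i"
    "int m dvd int j - int i - int k"
    using removable_node_iff[OF c] residue_eq_iff[OF assms(2)]
    by (auto simp: removable_nodes_def)
  then have "bead c i - 1 = gap c j" by (simp add: bead_def gap_def)
  then have "bead c i - 1 \<notin> beads c" using compl_beads[OF c] by auto
  then show ?R using ij by (simp add: bead_def)
next
  assume R: ?R
  then obtain j' where j': "bead c i - 1 = gap c j'" using compl_beads[OF c] by auto
  then have ij': "(i, j') \<in> c" using gap_less_bead_iff[OF c, of j' i] by simp
  then have "j' < row_len c i" "i < col_len c j'" using c mem_iff_row_len mem_iff_col_len by auto
  with j' have len: "row_len c i = Suc j'" "col_len c j' = Suc i" by (auto simp: bead_def gap_def)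
  then have "j' = j" using R by (simp add: bead_def)
  then show ?L
    using len R ij' removable_node_iff[OF c ij'] residue_eq_iff[OF assms(2), of i j]
    by (simp add: removable_nodes_def bead_def)
qed

lemma mem_addable_iff:
  assumes c: "is_partition c" and "k < m"
  shows "(i, j) \<in> addable_nodes m k c \<longleftrightarrow>
    int j = bead c i + int i \<and> bead c i + 1 \<notin> beads c \<and> int m dvd bead c i - int k"
    (is "?L \<longleftrightarrow> ?R")
proof
  assume ?L
  then have ij: "(i, j) \<notin> c" "row_len c i = j" "col_len c j = i"
    "int m dvd int j - int i - int k"
    using addable_node_iff[OF c] residue_eq_iff[OF assms(2)]
    by (auto simp: addable_nodes_def)
  then have "bead c i + 1 = gap c j" by (simp add: bead_def gap_def)
  then have "bead c i + 1 \<notin> beads c" using compl_beads[OF c] by auto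
  then show ?R using ij by (simp add: bead_def)
next
  assume R: ?R
  then obtain j' where j': "bead c i + 1 = gap c j'" using compl_beads[OF c] by auto
  then have ij': "(i, j') \<notin> c" using gap_less_bead_iff[OF c, of j' i] by simp
  then have "\<not> j' < row_len c i" "\<not> i < col_len c j'"
    using c mem_iff_row_len mem_iff_col_len by auto
  with j' have len: "row_len c i = j'" "col_len c j' = i" by (auto simp: bead_def gap_def)
  then have "j' = j" using R by (simp add: bead_def)
  then show ?L
    using len R ij' addable_node_iff[OF c ij'] residue_eq_iff[OF assms(2), of i j]
    by (simp add: addable_nodes_def bead_def)
qed

lemma partition_remove:
  assumes c: "is_partition c"
  shows "is_partition (c - removable_nodes m k c)"
proof -
  have "(a', b') \<in> c - removable_nodes m k c"
    if "(a, b) \<in> c - removable_nodes m k c" "a' \<le> a" "b' \<le> b" for a b a' b'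
  proof -
    have "(a', b') \<notin> removable_nodes m k c"
    proof
      assume r: "(a', b') \<in> removable_nodes m k c"
      then have p: "is_partition (c - {(a', b')})" by (simp add: removable_nodes_def)
      have "(a, b) \<in> c - {(a', b')}" using that(1) r by auto
      from partition_downclosed[OF p this that(2,3)] show False by simp
    qed
    then show ?thesis using that partition_downclosed[OF c, of a b a' b'] by simp
  qed
  then show ?thesis
    using partition_finite[OF c] unfolding is_partition_def by (metis finite_Diff)
qed

lemma partition_add:
  assumes c: "is_partition c"
  shows "is_partition (c \<union> addable_nodes m k c)"
proof -
  have "(a', b') \<in> c \<union> addable_nodes m k c"
    if "(a, b) \<in> c \<union> addable_nodes m k c" "a' \<le> a" "b' \<le> b" for a b a' b'
  proof (cases "(a, b) \<in> c")
    case True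
    then show ?thesis using partition_downclosed[OF c] that by blast
  next
    case False
    with that(1) have r: "(a, b) \<in> addable_nodes m k c" by simp
    then have p: "is_partition (insert (a, b) c)" by (simp add: addable_nodes_def)
    from partition_downclosed[OF p _ that(2,3)] show ?thesis using r by auto
  qed
  moreover have "finite (addable_nodes m k c)"
  proof -
    have "addable_nodes m k c \<subseteq> insert 0 (Suc ` fst ` c) \<times> insert 0 (Suc ` snd ` c)"
    proof (clarify)
      fix i j assume ij: "(i, j) \<in> addable_nodes m k c"
      then have p: "is_partition (insert (i, j) c)" by (simp add: addable_nodes_def)
      have "i \<in> insert 0 (Suc ` fst ` c)"
      proof (cases i)
        case (Suc i')
        then show ?thesis using partition_downclosed[OF p, of i j i' j] by (force simp: image_iff)
      qed simp
      moreover have "j \<in> insert 0 (Suc ` snd ` c)"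
      proof (cases j)
        case (Suc j')
        then show ?thesis using partition_downclosed[OF p, of i j i j'] by (force simp: image_iff)
      qed simp
      ultimately show "i \<in> insert 0 (Suc ` fst ` c) \<and> j \<in> insert 0 (Suc ` snd ` c)" ..
    qed
    then show ?thesis by (rule finite_subset) (use partition_finite[OF c] in auto)
  qed
  ultimately show ?thesis
    using partition_finite[OF c] unfolding is_partition_def by (metis finite_Un)
qed

lemma bead_remove:
  assumes c: "is_partition c" and "k < m"
  shows "bead (c - removable_nodes m k c) i =
    (if bead c i - 1 \<notin> beads c \<and> int m dvd bead c i - 1 - int k then bead c i - 1 else bead c i)"
proof -
  define P where "P \<longleftrightarrow> bead c i - 1 \<notin> beads c \<and> int m dvd bead c i - 1 - int k"
  have *: "(i, j) \<in> c - removable_nodes m k c \<longleftrightarrow> j < row_len c i - (if P then 1 else 0)" for j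
  proof -
    have "(i, j) \<in> removable_nodes m k c \<longleftrightarrow> int j = bead c i - 1 + int i \<and> P"
      unfolding P_def by (rule mem_removable_iff[OF assms])
    then show ?thesis using mem_iff_row_len[OF c, of i j] by (auto simp: bead_def)
  qed
  then have "row_len (c - removable_nodes m k c) i = row_len c i - (if P then 1 else 0)"
    by (simp only: row_len_def[of "c - _"] *) simp
  moreover have "row_len c i > 0" if P
  proof -
    have "bead c i - 1 \<in> - beads c" using that by (simp add: P_def)
    then obtain j where j: "bead c i - 1 = gap c j" unfolding compl_beads[OF c] by (rule rangeE)
    then have "(i, j) \<in> c" using gap_less_bead_iff[OF c, of j i] by simp
    then show ?thesis using c mem_iff_row_len by (metis gr_zeroI not_less_zero)
  qed
  ultimately show ?thesis
    unfolding P_def[symmetric] by (simp add: bead_def of_nat_diff Suc_leI)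
qed

lemma bead_add:
  assumes c: "is_partition c" and "k < m"
  shows "bead (c \<union> addable_nodes m k c) i =
    (if bead c i + 1 \<notin> beads c \<and> int m dvd bead c i - int k then bead c i + 1 else bead c i)"
proof -
  define P where "P \<longleftrightarrow> bead c i + 1 \<notin> beads c \<and> int m dvd bead c i - int k"
  have *: "(i, j) \<in> c \<union> addable_nodes m k c \<longleftrightarrow> j < row_len c i + (if P then 1 else 0)" for j
  proof -
    have "(i, j) \<in> addable_nodes m k c \<longleftrightarrow> int j = bead c i + int i \<and> P"
      unfolding P_def by (rule mem_addable_iff[OF assms])
    then show ?thesis using mem_iff_row_len[OF c, of i j] by (auto simp: bead_def)
  qed
  then have "row_len (c \<union> addable_nodes m k c) i = row_len c i + (if P then 1 else 0)"
    by (simp only: row_len_def[of "c \<union> _"] *) simp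
  then show ?thesis unfolding P_def[symmetric] by (simp add: bead_def)
qed

text \<open>In each residue class the beads of a core form a downward ray. With \<open>y\<close> in the class of \<open>x - 1\<close>, the
ray of the class of \<open>x\<close> must end both at or above \<open>x\<close> and below \<open>y + 1\<close>, and the ray of the class of
\<open>y\<close> both at or above \<open>y\<close> and below \<open>x - 1\<close>; these are incompatible.\<close>

lemma core_not_removable_and_addable:
  fixes m k :: int
  assumes core: "\<And>x. x \<in> B \<Longrightarrow> x - m \<in> B" and "m > 0"
    and x: "x \<in> B" "x - 1 \<notin> B" "m dvd x - 1 - k"
    and y: "y \<in> B" "y + 1 \<notin> B" "m dvd y - k"
  shows False
proof -
  have iter: "z - m * int q \<in> B" if "z \<in> B" for z q
  proof (induction q)
    case (Suc q)
    then show ?case using core[OF Suc] by (simp add: algebra_simps)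
  qed (use that in simp)
  have "m dvd (x - 1 - k) - (y - k)" using x(3) y(3) by (rule dvd_diff)
  then obtain q where "(x - 1 - k) - (y - k) = m * q" by (rule dvdE)
  then have q: "x - 1 - y = m * q" by simp
  show False
  proof (cases "q \<ge> 0")
    case True
    then have "x - m * int (nat q) = y + 1" using q by simp
    then show False using iter[OF x(1)] y(2) by metis
  next
    case False
    then have "y - m * int (nat (- q)) = x - 1" using q by simp
    then show False using iter[OF y(1)] x(2) by metis
  qed
qed

text \<open>Moving beads down where possible agrees with exchanging positions, as long as no bead can be moved
up: exchanging two occupied positions has no effect on the set.\<close>

lemma shift_down_eq_adj_swap:
  fixes m k :: int
  assumes "m \<ge> 2" and no_addable: "\<And>y. y \<in> B \<Longrightarrow> m dvd y - k \<Longrightarrow> y + 1 \<in> B"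
  shows "(\<lambda>x. if x - 1 \<notin> B \<and> m dvd x - 1 - k then x - 1 else x) ` B = adj_swap m k -` B"
    (is "?f ` B = _")
proof (rule Set.set_eqI)
  fix y
  have ndvd: "\<not> m dvd a" if "m dvd a - 1 \<or> m dvd a + 1" for a
    using not_dvd_near[of m _ a] that \<open>m \<ge> 2\<close> by fastforce
  consider "m dvd y - k" | "m dvd y - k - 1" | "\<not> m dvd y - k" "\<not> m dvd y - k - 1" by blast
  then show "y \<in> ?f ` B \<longleftrightarrow> y \<in> adj_swap m k -` B"
  proof cases
    case 1
    have "y \<in> ?f ` B" if "y + 1 \<in> B"
    proof (cases "y \<in> B")
      case True
      have "\<not> m dvd y - 1 - k" using ndvd[of "y - 1 - k"] 1 by simp
      then show ?thesis using True by (intro image_eqI[of _ _ y]) auto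
    next
      case False
      then show ?thesis using that 1 by (intro image_eqI[of _ _ "y + 1"]) auto
    qed
    moreover have "y + 1 \<in> B" if "y \<in> ?f ` B"
      using that no_addable[of y] 1 by (auto split: if_splits)
    ultimately show ?thesis using 1 by (auto simp: adj_swap_up)
  next
    case 2
    then have d: "m dvd y - 1 - k" by (simp add: algebra_simps)
    have "\<not> m dvd y - k" using ndvd[of "y - k"] 2 by simp
    then have "y \<in> ?f ` B \<longleftrightarrow> y \<in> B \<and> y - 1 \<in> B"
      using d by (auto simp: image_iff split: if_splits)
    also have "\<dots> \<longleftrightarrow> y - 1 \<in> B" using no_addable[of "y - 1"] d by auto
    finally show ?thesis using adj_swap_down[OF assms(1) 2] by simp
  next
    case 3
    then have "y \<in> ?f ` B \<longleftrightarrow> y \<in> B"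
      by (auto simp: image_iff algebra_simps split: if_splits)
    then show ?thesis using 3 by (simp add: adj_swap_fix)
  qed
qed

lemma shift_up_eq_adj_swap:
  fixes m k :: int
  assumes "m \<ge> 2" and no_removable: "\<And>y. y \<in> B \<Longrightarrow> m dvd y - 1 - k \<Longrightarrow> y - 1 \<in> B"
  shows "(\<lambda>x. if x + 1 \<notin> B \<and> m dvd x - k then x + 1 else x) ` B = adj_swap m k -` B"
    (is "?f ` B = _")
proof (rule Set.set_eqI)
  fix y
  have ndvd: "\<not> m dvd a" if "m dvd a - 1 \<or> m dvd a + 1" for a
    using not_dvd_near[of m _ a] that \<open>m \<ge> 2\<close> by fastforce
  consider "m dvd y - k" | "m dvd y - k - 1" | "\<not> m dvd y - k" "\<not> m dvd y - k - 1" by blast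
  then show "y \<in> ?f ` B \<longleftrightarrow> y \<in> adj_swap m k -` B"
  proof cases
    case 1
    have "\<not> m dvd y - 1 - k" using ndvd[of "y - 1 - k"] 1 by simp
    then have "y \<in> ?f ` B \<longleftrightarrow> y \<in> B \<and> y + 1 \<in> B"
      using 1 by (auto simp: image_iff split: if_splits)
    also have "\<dots> \<longleftrightarrow> y + 1 \<in> B" using no_removable[of "y + 1"] 1 by auto
    finally show ?thesis using 1 by (simp add: adj_swap_up)
  next
    case 2
    then have d: "m dvd y - 1 - k" by (simp add: algebra_simps)
    have nd: "\<not> m dvd y - k" using ndvd[of "y - k"] 2 by simp
    have "y \<in> ?f ` B" if "y - 1 \<in> B"
    proof (cases "y \<in> B")
      case True
      then show ?thesis using nd by (intro image_eqI[of _ _ y]) auto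
    next
      case False
      then show ?thesis using that d by (intro image_eqI[of _ _ "y - 1"]) auto
    qed
    moreover have "y - 1 \<in> B" if "y \<in> ?f ` B"
      using that no_removable[of y] d by (auto split: if_splits)
    ultimately show ?thesis using adj_swap_down[OF assms(1) 2] by auto
  next
    case 3
    then have "y \<in> ?f ` B \<longleftrightarrow> y \<in> B"
      by (auto simp: image_iff algebra_simps split: if_splits)
    then show ?thesis using 3 by (simp add: adj_swap_fix)
  qed
qed

lemma partition_simple_act:
  "is_partition c \<Longrightarrow> is_partition (simple_act m k c)"
  by (simp add: simple_act_def partition_remove partition_add)

text \<open>Whichever branch of \<open>simple_act\<close> applies, the beads that can move all move in the same direction,
because a core does not have removable and addable nodes of one residue together.\<close>

lemma beads_simple_act:
  assumes "c \<in> cores m" "k < m" "m \<ge> 2"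
  shows "beads (simple_act m k c) = adj_swap (int m) (int k) -` beads c"
proof -
  let ?B = "beads c"
  have c: "is_partition c" and core: "\<And>x. x \<in> ?B \<Longrightarrow> x - int m \<in> ?B"
    using assms cores_iff[of m c] by auto
  have m: "int m \<ge> 2" using assms by simp
  have rem: "removable_nodes m k c \<noteq> {} \<longleftrightarrow> (\<exists>x\<in>?B. x - 1 \<notin> ?B \<and> int m dvd x - 1 - int k)"
  proof
    assume "removable_nodes m k c \<noteq> {}"
    then obtain i j where "(i, j) \<in> removable_nodes m k c" by auto
    then show "\<exists>x\<in>?B. x - 1 \<notin> ?B \<and> int m dvd x - 1 - int k"
      unfolding mem_removable_iff[OF c assms(2)] by (auto simp: beads_def)
  next
    assume "\<exists>x\<in>?B. x - 1 \<notin> ?B \<and> int m dvd x - 1 - int k"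
    then obtain i where i: "bead c i - 1 \<notin> ?B" "int m dvd bead c i - 1 - int k"
      by (auto simp: beads_def)
    then obtain j where "bead c i - 1 = gap c j" using compl_beads[OF c] by auto
    then have "(i, j) \<in> c" using gap_less_bead_iff[OF c, of j i] by simp
    then have "bead c i - 1 + int i \<ge> 0"
      using mem_iff_row_len[OF c, of i j] by (simp add: bead_def)
    then have "(i, nat (bead c i - 1 + int i)) \<in> removable_nodes m k c"
      using i unfolding mem_removable_iff[OF c assms(2)] by simp
    then show "removable_nodes m k c \<noteq> {}" by blast
  qed
  show ?thesis
  proof (cases "removable_nodes m k c = {}")
    case False
    then obtain x where x: "x \<in> ?B" "x - 1 \<notin> ?B" "int m dvd x - 1 - int k" using rem by blast
    have "simple_act m k c = c - removable_nodes m k c" using False by (simp add: simple_act_def)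
    let ?f = "\<lambda>x. if x - 1 \<notin> ?B \<and> int m dvd x - 1 - int k then x - 1 else x"
    have "beads (simple_act m k c) = range (\<lambda>i. ?f (bead c i))"
      using \<open>simple_act m k c = _\<close> unfolding beads_def[of "simple_act m k c"]
      by (intro arg_cong[of _ _ range] ext) (simp only: bead_remove[OF c assms(2)])
    also have "\<dots> = ?f ` ?B" unfolding beads_def by (rule image_image[symmetric])
    also have "\<dots> = adj_swap (int m) (int k) -` ?B"
      by (rule shift_down_eq_adj_swap[OF m])
        (use core_not_removable_and_addable[OF core _ x] m in fastforce)
    finally show ?thesis .
  next
    case True
    have "simple_act m k c = c \<union> addable_nodes m k c" using True by (auto simp: simple_act_def)
    let ?f = "\<lambda>x. if x + 1 \<notin> ?B \<and> int m dvd x - int k then x + 1 else x"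
    have "beads (simple_act m k c) = range (\<lambda>i. ?f (bead c i))"
      using \<open>simple_act m k c = _\<close> unfolding beads_def[of "simple_act m k c"]
      by (intro arg_cong[of _ _ range] ext) (simp only: bead_add[OF c assms(2)])
    also have "\<dots> = ?f ` ?B" unfolding beads_def by (rule image_image[symmetric])
    also have "\<dots> = adj_swap (int m) (int k) -` ?B"
      by (rule shift_up_eq_adj_swap[OF m]) (use rem True in blast)
    finally show ?thesis .
  qed
qed

lemma simple_act_core:
  assumes "c \<in> cores m" "k < m" "m \<ge> 2"
  shows "simple_act m k c \<in> cores m"
proof -
  have "is_partition (simple_act m k c)"
    using assms by (simp add: partition_simple_act cores_def)
  moreover have "adj_swap (int m) (int k) (x - int m) = adj_swap (int m) (int k) x - int m" for x
    using adj_swap_shift[of "int m" "- int m" "int k" x] by simp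
  ultimately show ?thesis
    using assms by (simp add: cores_iff beads_simple_act)
qed

subsection \<open>Words of simple reflections\<close>

text \<open>The beads of \<open>word_act m w c\<close> are the preimage of those of \<open>c\<close> under this permutation. Taking
preimages reverses the order of composition, so the first letter, which acts last on cores, is
applied first to positions.\<close>

definition word_perm :: "nat \<Rightarrow> nat list \<Rightarrow> int \<Rightarrow> int" where
  "word_perm m = fold (\<lambda>k. adj_swap (int m) (int k))"

abbreviation word_act :: "nat \<Rightarrow> nat list \<Rightarrow> (nat \<times> nat) set \<Rightarrow> (nat \<times> nat) set" where
  "word_act m w c \<equiv> foldr (simple_act m) w c"

lemma word_perm_simps [simp]:
  "word_perm m [] x = x"
  "word_perm m (k # w) x = word_perm m w (adj_swap (int m) (int k) x)"
  "word_perm m (u @ v) x = word_perm m v (word_perm m u x)"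
  by (simp_all add: word_perm_def)

lemma word_act_core:
  assumes "m \<ge> 2" "w \<in> lists {..<m}" "c \<in> cores m"
  shows "word_act m w c \<in> cores m"
  using assms(2) by (induction w) (auto simp: assms simple_act_core)

lemma beads_word_act:
  assumes "m \<ge> 2" "w \<in> lists {..<m}" "c \<in> cores m"
  shows "beads (word_act m w c) = word_perm m w -` beads c"
  using assms(2)
proof (induction w)
  case (Cons k w)
  then have "beads (word_act m (k # w) c) = adj_swap (int m) (int k) -` beads (word_act m w c)"
    using assms by (simp add: beads_simple_act word_act_core)
  then show ?case using Cons by auto
qed auto

text \<open>Bead sets are faithful, so relations among the permutations of positions hold for the action on cores.\<close>

lemma word_act_cong:
  assumes "m \<ge> 2" "u \<in> lists {..<m}" "v \<in> lists {..<m}" "c \<in> cores m"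
    and "\<And>x. word_perm m u x = word_perm m v x"
  shows "word_act m u c = word_act m v c"
proof (rule beads_inject)
  show "is_partition (word_act m u c)" "is_partition (word_act m v c)"
    using word_act_core[OF assms(1) _ assms(4)] assms(2,3) by (auto simp: cores_def)
  show "beads (word_act m u c) = beads (word_act m v c)"
    using assms by (simp add: beads_word_act vimage_def)
qed

lemma word_perm_shift:
  "word_perm m w (x + int m * q) = word_perm m w x + int m * q"
  by (induction w arbitrary: x) (simp_all add: adj_swap_shift)

lemma adj_swap_index_cong:
  assumes "m dvd k - l"
  shows "adj_swap m k = adj_swap m l"
proof
  fix x
  have "x - l = x - k + (k - l)" "x - l - 1 = x - k - 1 + (k - l)" by simp_all
  with assms have "m dvd x - l \<longleftrightarrow> m dvd x - k" "m dvd x - l - 1 \<longleftrightarrow> m dvd x - k - 1"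
    by (metis dvd_add_left_iff)+
  then show "adj_swap m k x = adj_swap m l x" by (simp add: adj_swap_def)
qed

lemma adj_swap_commute:
  assumes "m \<ge> 2" "\<not> m dvd k - l" "\<not> m dvd k - l - 1" "\<not> m dvd k - l + 1"
  shows "adj_swap m k (adj_swap m l x) = adj_swap m l (adj_swap m k x)"
proof -
  have fix_other: "adj_swap m a y = y"
    if "m dvd y - b \<or> m dvd y - b - 1" "\<not> m dvd a - b" "\<not> m dvd a - b - 1" "\<not> m dvd a - b + 1"
    for a b y
  proof (rule adj_swap_fix)
    show "\<not> m dvd y - a"
    proof
      assume "m dvd y - a"
      with that(1) have "m dvd (y - b) - (y - a) \<or> m dvd (y - b - 1) - (y - a)" by (meson dvd_diff)
      moreover have eqs: "(y - b) - (y - a) = a - b" "(y - b - 1) - (y - a) = a - b - 1"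
        by simp_all
      ultimately show False using that(2-4) unfolding eqs by blast
    qed
    show "\<not> m dvd y - a - 1"
    proof
      assume "m dvd y - a - 1"
      with that(1) have "m dvd (y - b) - (y - a - 1) \<or> m dvd (y - b - 1) - (y - a - 1)"
        by (meson dvd_diff)
      moreover have eqs: "(y - b) - (y - a - 1) = a - b + 1" "(y - b - 1) - (y - a - 1) = a - b"
        by simp_all
      ultimately show False using that(2-4) unfolding eqs by blast
    qed
  qed
  have moved: "m dvd adj_swap m b y - b \<or> m dvd adj_swap m b y - b - 1"
    if "m dvd y - b \<or> m dvd y - b - 1" for b y
    using that assms(1) by (auto simp: adj_swap_up adj_swap_down algebra_simps)
  have neg: "\<not> m dvd l - k" "\<not> m dvd l - k - 1" "\<not> m dvd l - k + 1"
    using assms(2-4) dvd_minus_iff[of m "k - l"] dvd_minus_iff[of m "k - l - 1"]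
      dvd_minus_iff[of m "k - l + 1"] by (simp_all add: algebra_simps)
  consider "m dvd x - k \<or> m dvd x - k - 1" | "m dvd x - l \<or> m dvd x - l - 1"
    | "adj_swap m k x = x" "adj_swap m l x = x"
    using adj_swap_fix by blast
  then show ?thesis
  proof cases
    case 1
    then show ?thesis using fix_other[OF 1 neg] fix_other[OF moved[OF 1] neg] by simp
  next
    case 2
    then show ?thesis
      using fix_other[OF 2 assms(2-4)] fix_other[OF moved[OF 2] assms(2-4)] by simp
  qed simp
qed

text \<open>Near a position \<open>y \<equiv> k\<close> the reflection of index \<open>k + d\<close> moves only \<open>y + d\<close> and \<open>y + d + 1\<close>, since the next
pairs that it moves are \<open>m\<close> steps away.\<close>

lemma adj_swap_near:
  assumes "m \<ge> 2" "m dvd y - k" "\<bar>c - d\<bar> < m" "\<bar>c - d - 1\<bar> < m"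
  shows "adj_swap m (k + d) (y + c) =
    (if c = d then y + c + 1 else if c = d + 1 then y + c - 1 else y + c)"
proof -
  have "m dvd y - k + e \<longleftrightarrow> e = 0" if "\<bar>e\<bar> < m" for e
    using not_dvd_near[OF assms(2), of "y - k + e"] assms(2) that by auto
  from this[OF assms(3)] this[OF assms(4)]
  have "m dvd y + c - (k + d) \<longleftrightarrow> c = d" "m dvd y + c - (k + d) - 1 \<longleftrightarrow> c = d + 1"
    by (simp_all add: algebra_simps)
  then show ?thesis by (simp add: adj_swap_def)
qed

text \<open>Both sides exchange \<open>x\<close> and \<open>x + 2\<close> for all \<open>x \<equiv> k\<close> and fix everything else; \<open>m \<ge> 3\<close> ensures that the
windows \<open>x, x + 1, x + 2\<close> are disjoint.\<close>

lemma adj_swap_braid: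
  assumes "m \<ge> 3"
  shows "adj_swap m k (adj_swap m (k + 1) (adj_swap m k x)) =
    adj_swap m (k + 1) (adj_swap m k (adj_swap m (k + 1) x))"
proof -
  have vals: "adj_swap m k y = y + 1" "adj_swap m k (y + 1) = y" "adj_swap m k (y + 2) = y + 2"
    "adj_swap m (k + 1) y = y" "adj_swap m (k + 1) (y + 1) = y + 2"
    "adj_swap m (k + 1) (y + 2) = y + 1" if "m dvd y - k" for y
    using assms adj_swap_near[OF _ that, of 0 0] adj_swap_near[OF _ that, of 1 0]
      adj_swap_near[OF _ that, of 2 0] adj_swap_near[OF _ that, of 0 1]
      adj_swap_near[OF _ that, of 1 1] adj_swap_near[OF _ that, of 2 1] by simp_all
  have "x - (k + 1) = x - 1 - k" "x - (k + 1) - 1 = x - 2 - k" "x - k - 1 = x - 1 - k"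
    by simp_all
  then consider "m dvd x - k" | "m dvd x - 1 - k" | "m dvd x - 2 - k"
    | "adj_swap m k x = x" "adj_swap m (k + 1) x = x"
    using adj_swap_fix[of m x k] adj_swap_fix[of m x "k + 1"] by metis
  then show ?thesis
  proof cases
    case 1
    then show ?thesis using vals[of x] by simp
  next
    case 2
    then show ?thesis using vals[of "x - 1"] by simp
  next
    case 3
    then show ?thesis using vals[of "x - 2"] by simp
  qed simp
qed

text \<open>The permutations of positions satisfy the Coxeter relations of the cyclic diagram. Around the cycle
the neighbour \<open>(i + 1) mod m\<close> acts like the index \<open>i + 1\<close>.\<close>

lemma word_perm_relator:
  assumes "m \<ge> 3" "i < m" "j < m"
  shows "word_perm m (concat (replicate (affine_A_matrix m i j) [i, j])) x = x"
proof -
  let ?s = "\<lambda>k. adj_swap (int m) (int k)"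
  have m: "int m \<ge> 2" using assms by simp
  have order3: "?s b (?s a (?s b (?s a (?s b (?s a y))))) = y \<and>
      ?s a (?s b (?s a (?s b (?s a (?s b y))))) = y" if "b = (a + 1) mod m" for a b y
  proof -
    have "int m dvd int b - (int a + 1)"
      using that by (simp add: zmod_int mod_eq_dvd_iff[symmetric] add.commute)
    then have "?s b = adj_swap (int m) (int a + 1)" by (rule adj_swap_index_cong)
    then have "?s a (?s b (?s a z)) = ?s b (?s a (?s b z))" for z
      using adj_swap_braid[of "int m" "int a"] assms by simp
    then show ?thesis using adj_swap_invol[OF m] by simp
  qed
  consider "i = j" | "j = (i + 1) mod m" "i \<noteq> j" | "i = (j + 1) mod m" "i \<noteq> j"
    | "i \<noteq> j" "j \<noteq> (i + 1) mod m" "i \<noteq> (j + 1) mod m" by blast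
  then show ?thesis
  proof cases
    case 1
    then show ?thesis using adj_swap_invol[OF m] by (simp add: affine_A_matrix_def)
  next
    case 2
    then show ?thesis
      using order3[of j i x] by (simp add: affine_A_matrix_def numeral_3_eq_3)
  next
    case 3
    then show ?thesis
      using order3[of i j x] by (simp add: affine_A_matrix_def numeral_3_eq_3)
  next
    case 4
    have nd: "\<not> int m dvd int a - int b + 1" if "b \<noteq> (a + 1) mod m" "b < m" for a b
    proof
      assume "int m dvd int a - int b + 1"
      then have "int (a + 1) mod int m = int b mod int m"
        by (simp add: mod_eq_dvd_iff algebra_simps)
      then have "(a + 1) mod m = b" using \<open>b < m\<close> by (metis of_nat_mod of_nat_eq_iff mod_less)
      then show False using that by simp
    qed
    have "\<not> int m dvd int i - int j"
    proof
      assume "int m dvd int i - int j"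
      then have "int i mod int m = int j mod int m" by (simp add: mod_eq_dvd_iff)
      then show False using assms 4 by simp
    qed
    moreover have "\<not> int m dvd int i - int j + 1" using nd[of j i] 4 assms by simp
    moreover have "\<not> int m dvd int i - int j - 1"
      using nd[of i j] 4 assms dvd_minus_iff[of "int m" "int i - int j - 1"]
      by (simp add: algebra_simps)
    ultimately have "?s i (?s j z) = ?s j (?s i z)" for z by (intro adj_swap_commute[OF m])
    then show ?thesis
      using 4 adj_swap_invol[OF m] by (simp add: affine_A_matrix_def numeral_2_eq_2)
  qed
qed

section \<open>Coxeter groups as quotients of words\<close>

definition word_class :: "'i set \<Rightarrow> ('i \<Rightarrow> 'i \<Rightarrow> nat) \<Rightarrow> 'i list \<Rightarrow> 'i list set" where
  "word_class I M w = coxeter_rel I M `` {w}"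

lemma mem_word_class_iff:
  "v \<in> word_class I M u \<longleftrightarrow> u \<in> lists I \<and> v \<in> lists I \<and> equivclp (coxeter_step I M) u v"
  by (simp add: word_class_def coxeter_rel_def)

lemma coxeter_step_context:
  assumes "coxeter_step I M u v"
  shows "coxeter_step I M (a @ u @ b) (a @ v @ b)"
  using assms
proof cases
  case (1 i j p q)
  then show ?thesis using coxeter_step.intros[of i I j M "a @ p" "q @ b"] by simp
qed

lemma equivclp_coxeter_context:
  assumes "equivclp (coxeter_step I M) u v"
  shows "equivclp (coxeter_step I M) (a @ u @ b) (a @ v @ b)"
  using assms
proof (induction rule: equivclp_induct)
  case (step y z)
  then have "equivclp (coxeter_step I M) (a @ y @ b) (a @ z @ b)"
    using coxeter_step_context[of I M _ _ a b] by (metis r_into_equivclp equivclp_sym)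
  then show ?case using step.IH by (metis equivclp_trans)
qed simp

lemma equiv_coxeter_rel: "equiv (lists I) (coxeter_rel I M)"
proof (rule equivI)
  show "coxeter_rel I M \<subseteq> lists I \<times> lists I" by (auto simp: coxeter_rel_def)
  show "refl_on (lists I) (coxeter_rel I M)" by (auto simp: coxeter_rel_def intro: refl_onI)
  show "sym (coxeter_rel I M)" by (auto simp: coxeter_rel_def intro: symI equivclp_sym)
  show "trans (coxeter_rel I M)" by (auto simp: coxeter_rel_def intro: transI equivclp_trans)
qed

lemma word_class_eqI:
  assumes "u \<in> lists I" "v \<in> lists I" "equivclp (coxeter_step I M) u v"
  shows "word_class I M u = word_class I M v"
  unfolding word_class_def
  using assms by (intro equiv_class_eq[OF equiv_coxeter_rel]) (simp add: coxeter_rel_def)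

lemma carrier_coxeter_group: "carrier (coxeter_group I M) = word_class I M ` lists I"
  by (auto simp: coxeter_group_def quotient_def word_class_def)

lemma one_coxeter_group: "\<one>\<^bsub>coxeter_group I M\<^esub> = word_class I M []"
  by (simp add: coxeter_group_def word_class_def)

lemma mult_coxeter_group:
  assumes "u \<in> lists I" "v \<in> lists I"
  shows "word_class I M u \<otimes>\<^bsub>coxeter_group I M\<^esub> word_class I M v = word_class I M (u @ v)"
proof -
  have "word_class I M (u' @ v') = word_class I M (u @ v)"
    if "u' \<in> word_class I M u" "v' \<in> word_class I M v" for u' v'
  proof (rule word_class_eqI)
    have uv: "u' \<in> lists I" "v' \<in> lists I" "equivclp (coxeter_step I M) u u'"
      "equivclp (coxeter_step I M) v v'" using that by (auto simp: mem_word_class_iff)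
    then show "u' @ v' \<in> lists I" "u @ v \<in> lists I" using assms by auto
    have "equivclp (coxeter_step I M) (u @ v) (u' @ v)"
      using equivclp_coxeter_context[OF uv(3), of "[]" v] by simp
    moreover have "equivclp (coxeter_step I M) (u' @ v) (u' @ v')"
      using equivclp_coxeter_context[OF uv(4), of u' "[]"] by simp
    ultimately show "equivclp (coxeter_step I M) (u' @ v') (u @ v)"
      by (metis equivclp_trans equivclp_sym)
  qed
  moreover have "u \<in> word_class I M u" "v \<in> word_class I M v"
    using assms by (auto simp: mem_word_class_iff)
  ultimately have "(\<Union>u'\<in>word_class I M u. \<Union>v'\<in>word_class I M v. word_class I M (u' @ v')) =
      word_class I M (u @ v)" by blast
  then show ?thesis by (simp add: coxeter_group_def word_class_def)
qed

lemma monoid_coxeter_group: "monoid (coxeter_group I M)"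
proof (rule monoidI)
  let ?G = "coxeter_group I M"
  show "\<one>\<^bsub>?G\<^esub> \<in> carrier ?G" by (simp add: carrier_coxeter_group one_coxeter_group)
next
  fix x y z assume "x \<in> carrier (coxeter_group I M)" "y \<in> carrier (coxeter_group I M)"
    "z \<in> carrier (coxeter_group I M)"
  then obtain u v w where uvw: "u \<in> lists I" "v \<in> lists I" "w \<in> lists I"
    and x: "x = word_class I M u" and y: "y = word_class I M v" and z: "z = word_class I M w"
    unfolding carrier_coxeter_group by (elim imageE)
  note mult = mult_coxeter_group[of _ I _ M]
  show "x \<otimes>\<^bsub>coxeter_group I M\<^esub> y \<in> carrier (coxeter_group I M)"
    unfolding x y mult[OF uvw(1,2)] carrier_coxeter_group
    using uvw by (intro imageI) (simp del: in_lists_conv_set)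
  have "[] \<in> lists I" "u @ v \<in> lists I" "v @ w \<in> lists I"
    using uvw by (simp_all del: in_lists_conv_set)
  then show "x \<otimes>\<^bsub>coxeter_group I M\<^esub> y \<otimes>\<^bsub>coxeter_group I M\<^esub> z =
      x \<otimes>\<^bsub>coxeter_group I M\<^esub> (y \<otimes>\<^bsub>coxeter_group I M\<^esub> z)"
    "\<one>\<^bsub>coxeter_group I M\<^esub> \<otimes>\<^bsub>coxeter_group I M\<^esub> x = x"
    "x \<otimes>\<^bsub>coxeter_group I M\<^esub> \<one>\<^bsub>coxeter_group I M\<^esub> = x"
    using uvw by (simp_all add: x y z one_coxeter_group mult del: in_lists_conv_set)
qed

text \<open>Inverses of generators contribute nothing new, because a generator whose square is trivial is its
own inverse.\<close>

lemma generate_involutive_word_classes: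
  assumes W: "W \<subseteq> lists I"
    and invol: "\<And>w. w \<in> W \<Longrightarrow> equivclp (coxeter_step I M) (w @ w) []"
  shows "generate (coxeter_group I M) (word_class I M ` W) =
    (\<lambda>ws. word_class I M (concat ws)) ` lists W" (is "generate ?G ?H = ?R")
proof
  have concat_lists: "concat ws \<in> lists I" if "ws \<in> lists W" for ws
    using that W by (induction ws) auto
  show "?R \<subseteq> generate ?G ?H"
  proof (rule image_subsetI)
    fix ws assume "ws \<in> lists W"
    then show "word_class I M (concat ws) \<in> generate ?G ?H"
    proof (induction ws)
      case Nil
      then show ?case using generate.one[of ?G ?H] by (simp add: one_coxeter_group)
    next
      case (Cons w ws)
      then have "word_class I M w \<otimes>\<^bsub>?G\<^esub> word_class I M (concat ws) \<in> generate ?G ?H"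
        by (intro generate.eng) (auto intro: generate.incl)
      moreover have "w \<in> lists I" "concat ws \<in> lists I" using concat_lists Cons.hyps W by auto
      ultimately show ?case by (simp add: mult_coxeter_group del: in_lists_conv_set)
    qed
  qed
  show "generate ?G ?H \<subseteq> ?R"
  proof
    fix g assume "g \<in> generate ?G ?H"
    then show "g \<in> ?R"
    proof (induction rule: generate.induct)
      case one
      show ?case by (rule image_eqI[of _ _ "[]"]) (simp_all add: one_coxeter_group)
    next
      case (incl h)
      then obtain w where "w \<in> W" "h = word_class I M w" by blast
      then show ?case by (intro image_eqI[of _ _ "[w]"]) auto
    next
      case (inv h)
      then obtain w where w: "w \<in> W" "h = word_class I M w" by blast
      then have wI: "w \<in> lists I" using W by auto
      have "h \<otimes>\<^bsub>?G\<^esub> h = \<one>\<^bsub>?G\<^esub>"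
        unfolding w(2) one_coxeter_group mult_coxeter_group[OF wI wI]
        by (rule word_class_eqI) (use wI invol[OF w(1)] in auto)
      moreover have "h \<in> carrier ?G" using w wI by (simp add: carrier_coxeter_group)
      ultimately have "inv\<^bsub>?G\<^esub> h = h"
        using monoid.inv_unique'[OF monoid_coxeter_group, of h I M h] by simp
      then show ?case using w by (intro image_eqI[of _ _ "[w]"]) auto
    next
      case (eng h1 h2)
      then obtain us vs where "us \<in> lists W" "vs \<in> lists W"
        "h1 = word_class I M (concat us)" "h2 = word_class I M (concat vs)" by blast
      then show ?case
        using mult_coxeter_group[OF concat_lists concat_lists, of us vs M]
        by (intro image_eqI[of _ _ "us @ vs"]) auto
    qed
  qed
qed

lemma word_perm_coxeter:
  assumes "m \<ge> 3" "equivclp (coxeter_step {..<m} (affine_A_matrix m)) u v"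
  shows "word_perm m u x = word_perm m v x"
proof -
  have step: "word_perm m y x = word_perm m z x"
    if "coxeter_step {..<m} (affine_A_matrix m) y z" for y z x
    using that by cases (simp add: word_perm_relator[OF assms(1)])
  from assms(2) show ?thesis
    by (induction rule: equivclp_induct) (use step in fastforce)+
qed

text \<open>The definite description in \<open>core_action\<close> denotes: all words of a class act alike on cores.\<close>

lemma core_action_word_class:
  assumes "m \<ge> 3" "w \<in> lists {..<m}" "c \<in> cores m"
  shows "core_action m (word_class {..<m} (affine_A_matrix m) w) c = word_act m w c"
proof -
  let ?A = "word_class {..<m} (affine_A_matrix m) w"
  have "word_act m w' c = word_act m w c" if "w' \<in> ?A" for w'
    using that assms word_perm_coxeter[OF assms(1)]
    by (intro word_act_cong) (auto simp: mem_word_class_iff)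
  moreover have "w \<in> ?A" using assms by (auto simp: mem_word_class_iff)
  ultimately have "(THE d. \<forall>w\<in>?A. word_act m w c = d) = word_act m w c"
    by (intro the_equality) (blast, metis)
  then show ?thesis using assms(3) by (simp add: core_action_def)
qed


section \<open>The twisted subgroup\<close>

definition twisted_gens :: "nat \<Rightarrow> nat list set" where
  "twisted_gens n =
    {[0, 1, 2 * n - 1, 0]} \<union> {[i, 2 * n - i] | i. 1 \<le> i \<and> i \<le> n - 1} \<union> {[n]}"

lemma twisted_gens_cases:
  assumes "g \<in> twisted_gens n"
  obtains (zero) "g = [0, 1, 2 * n - 1, 0]"
    | (pair) i where "1 \<le> i" "i < n" "g = [i, 2 * n - i]"
    | (last) "g = [n]"
proof -
  from assms consider "g = [0, 1, 2 * n - 1, 0]" | "g = [n]"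
    | i where "1 \<le> i" "i \<le> n - 1" "g = [i, 2 * n - i]"
    by (auto simp: twisted_gens_def)
  then show thesis
  proof cases
    case 3
    then show thesis using pair[of i] by simp
  qed (fact zero last)+
qed

lemma twisted_gens_lists:
  assumes "n \<ge> 3"
  shows "twisted_gens n \<subseteq> lists {..<2 * n}"
proof
  fix g assume "g \<in> twisted_gens n"
  then show "g \<in> lists {..<2 * n}"
    by (cases rule: twisted_gens_cases) (use assms in auto)
qed

lemma equivclp_cancel:
  assumes "i \<in> I" "j \<in> I" "w = concat (replicate (M i j) [i, j])"
  shows "equivclp (coxeter_step I M) (u @ w @ v) (u @ v)"
  using coxeter_step.intros[of i I j M u v] assms by (metis r_into_equivclp)

text \<open>The two letters of \<open>[i, 2 n - i]\<close> differ by an even number, so they are not adjacent on the cycle and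
commute. In the square of \<open>[0, 1, 2 n - 1, 0]\<close> the inner zeros cancel, then the square of the commuting
pair, then the outer zeros.\<close>

lemma twisted_gens_square:
  assumes "n \<ge> 3" "g \<in> twisted_gens n"
  shows "equivclp (coxeter_step {..<2 * n} (affine_A_matrix (2 * n))) (g @ g) []"
    (is "?eq (g @ g) []")
proof -
  have one: "?eq (u @ [i, i] @ v) (u @ v)" if "i < 2 * n" for i u v
    using that by (intro equivclp_cancel[of i _ i]) (auto simp: affine_A_matrix_def)
  have two: "?eq (u @ [i, j, i, j] @ v) (u @ v)"
    if "i < 2 * n" "j < 2 * n" "affine_A_matrix (2 * n) i j = 2" for i j u v
    using that by (intro equivclp_cancel[of i _ j]) (auto simp: numeral_2_eq_2)
  from assms(2) show ?thesis
  proof (cases rule: twisted_gens_cases)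
    case zero
    have "affine_A_matrix (2 * n) 1 (2 * n - 1) = 2" 
    proof -
      have "2 * n - 1 \<noteq> 1" "2 * n - 1 \<noteq> (1 + 1) mod (2 * n)" "(2 * n - 1 + 1) mod (2 * n) \<noteq> 1"
        using assms by simp_all
      then show ?thesis unfolding affine_A_matrix_def by metis
    qed
    then have "?eq [0, 1, 2 * n - 1, 1, 2 * n - 1, 0] [0, 0]"
      using two[of 1 "2 * n - 1" "[0]" "[0]"] assms by simp
    moreover have "?eq (g @ g) [0, 1, 2 * n - 1, 1, 2 * n - 1, 0]"
      using one[of 0 "[0, 1, 2 * n - 1]" "[1, 2 * n - 1, 0]"] assms zero by simp
    moreover have "?eq [0, 0] []" using one[of 0 "[]" "[]"] assms by simp
    ultimately show ?thesis by (metis equivclp_trans)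
  next
    case (pair i)
    have "(i + 1) mod (2 * n) = i + 1" using pair by simp
    moreover have "(2 * n - i + 1) mod (2 * n) \<noteq> i"
    proof (cases "i = 1")
      case False
      then have "(2 * n - i + 1) mod (2 * n) = 2 * n - i + 1" using pair by simp
      then show ?thesis using pair by simp
    qed (use assms in simp)
    moreover have "2 * n - i \<noteq> i + 1" by presburger
    ultimately have "affine_A_matrix (2 * n) i (2 * n - i) = 2"
      using pair by (simp add: affine_A_matrix_def)
    then show ?thesis using two[of i "2 * n - i" "[]" "[]"] pair by simp
  next
    case last
    then show ?thesis using one[of n "[]" "[]"] assms by simp
  qed
qed

lemma twisted_weyl_A_eq:
  assumes "n \<ge> 3"
  shows "twisted_weyl_A n =
    (\<lambda>ws. word_class {..<2 * n} (affine_A_matrix (2 * n)) (concat ws)) ` lists (twisted_gens n)"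
proof -
  let ?G = "affine_weyl_A (2 * n)" and ?s = "simple_refl (2 * n)"
  let ?c = "word_class {..<2 * n} (affine_A_matrix (2 * n))"
  have s: "?s i = ?c [i]" for i by (simp add: simple_refl_def word_class_def)
  have mult: "?c u \<otimes>\<^bsub>?G\<^esub> ?c v = ?c (u @ v)" if "set u \<subseteq> {..<2 * n}" "set v \<subseteq> {..<2 * n}" for u v
    unfolding affine_weyl_A_def by (rule mult_coxeter_group) (use that in auto)
  have "?s 0 \<otimes>\<^bsub>?G\<^esub> ?s 1 \<otimes>\<^bsub>?G\<^esub> ?s (2 * n - 1) \<otimes>\<^bsub>?G\<^esub> ?s 0 = ?c [0, 1, 2 * n - 1, 0]"
    using assms by (simp add: s mult)
  moreover have "?s i \<otimes>\<^bsub>?G\<^esub> ?s (2 * n - i) = ?c [i, 2 * n - i]" if "1 \<le> i" "i \<le> n - 1" for i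
    using that by (simp add: s mult)
  then have "{?s i \<otimes>\<^bsub>?G\<^esub> ?s (2 * n - i) | i. 1 \<le> i \<and> i \<le> n - 1} =
      ?c ` {[i, 2 * n - i] | i. 1 \<le> i \<and> i \<le> n - 1}" by (auto simp: image_iff)
  ultimately have "twisted_weyl_A n = generate ?G (?c ` twisted_gens n)"
    unfolding twisted_weyl_A_def Let_def twisted_gens_def image_Un by (simp add: s)
  then show ?thesis
    unfolding affine_weyl_A_def
    using generate_involutive_word_classes[OF twisted_gens_lists[OF assms], of "affine_A_matrix (2 * n)"]
      twisted_gens_square[OF assms] by simp
qed

lemma empty_core: "m > 0 \<Longrightarrow> {} \<in> cores m"
  by (simp add: cores_iff beads_empty partition_empty)

lemma orbit_empty_eq:
  assumes "n \<ge> 3"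
  shows "orbit (affine_weyl_A (2 * n)\<lparr>carrier := twisted_weyl_A n\<rparr>) (core_action (2 * n)) {} =
    (\<lambda>ws. word_act (2 * n) (concat ws) {}) ` lists (twisted_gens n)"
proof -
  have "concat ws \<in> lists {..<2 * n}" if "ws \<in> lists (twisted_gens n)" for ws
    using that twisted_gens_lists[OF assms] by (induction ws) auto
  then have "core_action (2 * n) (word_class {..<2 * n} (affine_A_matrix (2 * n)) (concat ws)) {} =
      word_act (2 * n) (concat ws) {}" if "ws \<in> lists (twisted_gens n)" for ws
    using that assms by (intro core_action_word_class empty_core) auto
  moreover have "orbit (affine_weyl_A (2 * n)\<lparr>carrier := twisted_weyl_A n\<rparr>) (core_action (2 * n)) {} =
      (\<lambda>A. core_action (2 * n) A {}) ` twisted_weyl_A n"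
    by (auto simp: orbit_def)
  ultimately show ?thesis by (simp add: twisted_weyl_A_eq[OF assms] image_image)
qed


section \<open>Self-conjugate cores are preserved\<close>

lemma adj_swap_reflect:
  assumes "m \<ge> 2"
  shows "adj_swap m k (1 - x) = 1 - adj_swap m (- k) x"
proof -
  have a: "1 - x - k = - (x - (- k) - 1)" "1 - x - k - 1 = - (x - (- k))" by simp_all
  have "m dvd 1 - x - k \<longleftrightarrow> m dvd x - (- k) - 1"
    unfolding a(1) dvd_minus_iff by (rule refl)
  moreover have "m dvd 1 - x - k - 1 \<longleftrightarrow> m dvd x - (- k)"
    unfolding a(2) dvd_minus_iff by (rule refl)
  ultimately show ?thesis
    using adj_swap_up[of m x "- k"] adj_swap_down[OF assms, of x "- k"] adj_swap_fix[of m x "- k"]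
      adj_swap_up[of m "1 - x" k] adj_swap_down[OF assms, of "1 - x" k] adj_swap_fix[of m "1 - x" k]
    by (cases "m dvd x - (- k)"; cases "m dvd x - (- k) - 1") simp_all
qed

lemma adj_swap_complement:
  assumes "i \<le> 2 * n"
  shows "adj_swap (2 * int n) (int (2 * n - i)) = adj_swap (2 * int n) (- int i)"
  by (rule adj_swap_index_cong) (use assms in \<open>simp add: of_nat_diff\<close>)

lemma adj_swap_pair_commute:
  assumes "1 \<le> i" "i < n"
  shows "adj_swap (2 * int n) (int i) (adj_swap (2 * int n) (- int i) x) =
    adj_swap (2 * int n) (- int i) (adj_swap (2 * int n) (int i) x)"
  by (rule adj_swap_commute; (rule zdvd_not_zless)?) (use assms in auto)

text \<open>The generator \<open>s\<^sub>0 s\<^sub>1 s\<^bsub>2n-1\<^esub> s\<^sub>0\<close> exchanges \<open>y - 1\<close> with \<open>y + 1\<close> and \<open>y\<close> with \<open>y + 2\<close> for every multiple \<open>y\<close>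
of \<open>2 n\<close>, and fixes all other positions.\<close>

lemma twisted_gen_zero_value:
  assumes "n \<ge> 3" "2 * int n dvd y"
  shows "word_perm (2 * n) [0, 1, 2 * n - 1, 0] (y - 1) = y + 1"
    "word_perm (2 * n) [0, 1, 2 * n - 1, 0] y = y + 2"
    "word_perm (2 * n) [0, 1, 2 * n - 1, 0] (y + 1) = y - 1"
    "word_perm (2 * n) [0, 1, 2 * n - 1, 0] (y + 2) = y"
proof -
  let ?m = "2 * int n"
  have y: "?m dvd y - 0" using assms by simp
  note near = adj_swap_near[OF _ y]
  have v: "adj_swap ?m 0 (y - 1) = y - 1" "adj_swap ?m 0 y = y + 1"
    "adj_swap ?m 0 (y + 1) = y" "adj_swap ?m 0 (y + 2) = y + 2"
    "adj_swap ?m 1 (y - 1) = y - 1" "adj_swap ?m 1 y = y"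
    "adj_swap ?m 1 (y + 1) = y + 2" "adj_swap ?m 1 (y + 2) = y + 1"
    "adj_swap ?m (- 1) (y - 1) = y" "adj_swap ?m (- 1) y = y - 1"
    "adj_swap ?m (- 1) (y + 1) = y + 1" "adj_swap ?m (- 1) (y + 2) = y + 2"
    using assms(1) near[of "-1" 0] near[of 0 0] near[of 1 0] near[of 2 0]
      near[of "-1" 1] near[of 0 1] near[of 1 1] near[of 2 1]
      near[of "-1" "-1"] near[of 0 "-1"] near[of 1 "-1"] near[of 2 "-1"] by simp_all
  have c: "adj_swap (2 * int n) (int (2 * n - 1)) = adj_swap (2 * int n) (- 1)"
    using adj_swap_complement[of 1 n] assms by simp
  show "word_perm (2 * n) [0, 1, 2 * n - 1, 0] (y - 1) = y + 1"
    "word_perm (2 * n) [0, 1, 2 * n - 1, 0] y = y + 2"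
    "word_perm (2 * n) [0, 1, 2 * n - 1, 0] (y + 1) = y - 1"
    "word_perm (2 * n) [0, 1, 2 * n - 1, 0] (y + 2) = y"
    using c by (simp_all add: v)
qed

lemma twisted_gen_zero_fix:
  assumes "n \<ge> 3" "\<not> 2 * int n dvd x + 1" "\<not> 2 * int n dvd x" "\<not> 2 * int n dvd x - 1"
    "\<not> 2 * int n dvd x - 2"
  shows "word_perm (2 * n) [0, 1, 2 * n - 1, 0] x = x"
proof -
  have c: "adj_swap (2 * int n) (int (2 * n - 1)) = adj_swap (2 * int n) (- 1)"
    using adj_swap_complement[of 1 n] assms by simp
  have "adj_swap (2 * int n) 0 x = x" "adj_swap (2 * int n) 1 x = x"
    "adj_swap (2 * int n) (- 1) x = x"
    by (rule adj_swap_fix; use assms in simp)+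
  then show ?thesis using c by simp
qed

lemma twisted_gen_invol:
  assumes "n \<ge> 3" "g \<in> twisted_gens n"
  shows "word_perm (2 * n) g (word_perm (2 * n) g x) = x"
  using word_perm_coxeter[OF _ twisted_gens_square[OF assms], of x] assms(1) by simp

text \<open>Reflecting at 1/2 turns index \<open>k\<close> into \<open>- k\<close>. This permutes the commuting letters of each generator
and fixes the letters 0 and \<open>n\<close>.\<close>

lemma twisted_gen_reflect:
  assumes "n \<ge> 3" "g \<in> twisted_gens n"
  shows "word_perm (2 * n) g (1 - x) = 1 - word_perm (2 * n) g x"
proof -
  have m: "2 * int n \<ge> 2" using assms by simp
  note refl = adj_swap_reflect[OF m]
  from assms(2) show ?thesis
  proof (cases rule: twisted_gens_cases)
    case zero
    have c: "adj_swap (2 * int n) (int (2 * n - 1)) = adj_swap (2 * int n) (- 1)"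
      using adj_swap_complement[of 1 n] assms by simp
    show ?thesis using adj_swap_pair_commute[of 1 n] assms(1) c zero refl by simp
  next
    case (pair i)
    then show ?thesis
      using adj_swap_pair_commute[of i n] adj_swap_complement[of i n] refl by simp
  next
    case last
    have "adj_swap (2 * int n) (- int n) = adj_swap (2 * int n) (int n)"
      by (rule adj_swap_index_cong) simp
    then show ?thesis using last refl by simp
  qed
qed

lemma word_perm_pos_iff:
  assumes "m \<ge> 2" "set w \<subseteq> {0<..<m}"
  shows "0 < word_perm m w x \<longleftrightarrow> 0 < x"
  using assms(2)
proof (induction w arbitrary: x)
  case (Cons k w)
  have k: "0 < k" "k < m" using Cons.prems by auto
  have "0 < adj_swap (int m) (int k) x \<longleftrightarrow> 0 < x"
  proof -
    have "\<not> int m dvd 0 - int k" using k zdvd_not_zless[of "int k" "int m"] by simp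
    then have "x \<noteq> 0" if "int m dvd x - int k" using that by auto
    moreover have "\<not> int m dvd 1 - int k - 1" using k zdvd_not_zless[of "int k" "int m"] by simp
    then have "x \<noteq> 1" if "int m dvd x - int k - 1" using that by auto
    ultimately show ?thesis unfolding adj_swap_def by auto
  qed
  then show ?case using Cons by simp
qed simp

text \<open>This generator permutes windows \<open>{y - 1, ..., y + 2}\<close> around the multiples \<open>y\<close> of \<open>2 n\<close>; those for
\<open>y \<noteq> 0\<close> lie entirely above or entirely below \<open>{-1, ..., 2}\<close>.\<close>

lemma twisted_gen_zero_above_iff:
  assumes "n \<ge> 3"
  shows "2 < word_perm (2 * n) [0, 1, 2 * n - 1, 0] x \<longleftrightarrow> 2 < x"
proof -
  let ?m = "2 * int n"
  have small: "y = 0" if "?m dvd y" "- 3 \<le> y" "y \<le> 3" for y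
  proof (rule ccontr)
    assume "y \<noteq> 0"
    then have "\<bar>?m\<bar> \<le> \<bar>y\<bar>" using that(1) by (rule dvd_imp_le_int)
    then show False using that assms by linarith
  qed
  note v = twisted_gen_zero_value[OF assms]
  consider "?m dvd x + 1" | "?m dvd x" | "?m dvd x - 1" | "?m dvd x - 2"
    | "word_perm (2 * n) [0, 1, 2 * n - 1, 0] x = x"
    using twisted_gen_zero_fix[OF assms] by blast
  then show ?thesis
  proof cases
    case 1
    have "\<not> (0 < x \<and> x \<le> 2)" using small[OF 1] by auto
    then show ?thesis using v(1)[OF 1] by auto
  next
    case 2
    have "\<not> (0 < x \<and> x \<le> 2)" using small[OF 2] by auto
    then show ?thesis using v(2)[OF 2] by auto
  next
    case 3
    have "\<not> (2 < x \<and> x \<le> 4)" using small[OF 3] by auto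
    then show ?thesis using v(3)[OF 3] by auto
  next
    case 4
    have "\<not> (2 < x \<and> x \<le> 4)" using small[OF 4] by auto
    then show ?thesis using v(4)[OF 4] by auto
  qed simp
qed

text \<open>The generator with letters 0 is the only one that moves positions across the origin. It replaces the
occupancies of 1 and 2 by those of \<open>-1\<close> and 0, which by symmetry are the negated occupancies of 2 and
1; the number \<open>b\<close> of beads in \<open>{1, 2}\<close> becomes \<open>2 - b\<close>, of the same parity.\<close>

lemma twisted_gen_parity:
  assumes "n \<ge> 3" "g \<in> twisted_gens n"
    and sym: "\<And>x. x \<in> B \<longleftrightarrow> 1 - x \<notin> B" and fin: "finite {x \<in> B. 0 < x}"
  shows "even (card {x \<in> word_perm (2 * n) g -` B. 0 < x}) \<longleftrightarrow> even (card {x \<in> B. 0 < x})"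
proof -
  let ?p = "word_perm (2 * n) g"
  have bij: "bij ?p" by (rule o_bij[of ?p]) (auto simp: twisted_gen_invol[OF assms(1,2)])
  have card_vimage: "card (?p -` A) = card A" for A
    using bij by (intro card_vimage_inj) (auto simp: bij_def)
  show ?thesis
  proof (cases "set g \<subseteq> {0<..<2 * n}")
    case True
    then have "{x \<in> ?p -` B. 0 < x} = ?p -` {x \<in> B. 0 < x}"
      using word_perm_pos_iff[of "2 * n" g] assms(1) by auto
    then show ?thesis by (simp only: card_vimage)
  next
    case False
    with assms(2) have g: "g = [0, 1, 2 * n - 1, 0]"
      by (cases rule: twisted_gens_cases) (use assms(1) in auto)
    have p: "?p 1 = - 1" "?p 2 = 0"
      using twisted_gen_zero_value(3,4)[OF assms(1), of 0] unfolding g by simp_all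
    have split: "card {x \<in> C. 0 < x} =
        card {x \<in> C. 2 < x} + (if 1 \<in> C then 1 else 0) + (if 2 \<in> C then 1 else 0)"
      if "finite {x \<in> C. 2 < x}" for C :: "int set"
    proof -
      have "{x \<in> C. 0 < x} = {x \<in> C. 2 < x} \<union> ({1} \<inter> C \<union> {2} \<inter> C)" by auto
      moreover have "card \<dots> = card {x \<in> C. 2 < x} + card ({1} \<inter> C \<union> {2} \<inter> C)"
        using that by (intro card_Un_disjoint) auto
      moreover have "card ({1} \<inter> C \<union> {2} \<inter> C) = card ({1} \<inter> C) + card ({2} \<inter> C)"
        by (intro card_Un_disjoint) auto
      ultimately show ?thesis by auto
    qed
    have fin2: "finite {x \<in> B. 2 < x}" by (rule finite_subset[OF _ fin]) auto
    have pre: "{x \<in> ?p -` B. 2 < x} = ?p -` {x \<in> B. 2 < x}"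
      using twisted_gen_zero_above_iff[OF assms(1)] unfolding g by auto
    have "finite (?p -` {x \<in> B. 2 < x})"
      using fin2 bij by (intro finite_vimageI) (auto simp: bij_def)
    then have "card {x \<in> ?p -` B. 0 < x} = card {x \<in> B. 2 < x} +
        (if - 1 \<in> B then 1 else 0) + (if 0 \<in> B then 1 else 0)"
      using split[of "?p -` B"] by (simp only: pre card_vimage) (simp add: p)
    moreover have "- 1 \<in> B \<longleftrightarrow> 2 \<notin> B" "0 \<in> B \<longleftrightarrow> 1 \<notin> B" using sym[of "- 1"] sym[of 0] by auto
    ultimately show ?thesis using split[OF fin2] by auto
  qed
qed

lemma mem_sc_even_cores_iff:
  "c \<in> sc_even_cores m \<longleftrightarrow> c \<in> cores m \<and> (\<forall>x. x \<in> beads c \<longleftrightarrow> 1 - x \<notin> beads c) \<and>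
    even (card {x \<in> beads c. 0 < x})"
proof (cases "c \<in> cores m")
  case True
  then have "is_partition c" by (simp add: cores_def)
  from self_conjugate_iff[OF this] card_diagonal[OF this] True show ?thesis
    by (simp only: sc_even_cores_def mem_Collect_eq simp_thms)
qed (simp add: sc_even_cores_def)

lemma finite_positive_beads:
  assumes "is_partition c"
  shows "finite {x \<in> beads c. 0 < x}"
proof -
  obtain U where "\<And>z. U < z \<Longrightarrow> z \<notin> beads c" using beads_bounded[OF assms] by metis
  then have "{x \<in> beads c. 0 < x} \<subseteq> {0..U}" by force
  then show ?thesis by (rule finite_subset) simp
qed

lemma word_act_sc_even_core:
  assumes "n \<ge> 3" "g \<in> twisted_gens n" "c \<in> sc_even_cores (2 * n)"
  shows "word_act (2 * n) g c \<in> sc_even_cores (2 * n)"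
proof -
  have g: "g \<in> lists {..<2 * n}" using twisted_gens_lists assms by blast
  have c: "c \<in> cores (2 * n)" and sym: "\<And>x. x \<in> beads c \<longleftrightarrow> 1 - x \<notin> beads c"
    and par: "even (card {x \<in> beads c. 0 < x})"
    using assms(3) unfolding mem_sc_even_cores_iff by blast+
  have m: "2 * n \<ge> 2" using assms by simp
  have fin: "finite {x \<in> beads c. 0 < x}" using c finite_positive_beads by (auto simp: cores_def)
  show ?thesis
    unfolding mem_sc_even_cores_iff beads_word_act[OF m g c]
  proof (intro conjI allI)
    show "word_act (2 * n) g c \<in> cores (2 * n)" by (rule word_act_core[OF m g c])
    show "even (card {x \<in> word_perm (2 * n) g -` beads c. 0 < x})"
      using twisted_gen_parity[OF assms(1,2) sym fin] par by blast
    show "x \<in> word_perm (2 * n) g -` beads c \<longleftrightarrow> 1 - x \<notin> word_perm (2 * n) g -` beads c" for x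
      using sym[of "word_perm (2 * n) g x"] twisted_gen_reflect[OF assms(1,2), of x] by auto
  qed
qed

lemma word_act_twisted_gen_invol:
  assumes "n \<ge> 3" "g \<in> twisted_gens n" "c \<in> cores (2 * n)"
  shows "word_act (2 * n) g (word_act (2 * n) g c) = c"
proof -
  have "g \<in> lists {..<2 * n}" using twisted_gens_lists assms by blast
  then have "word_act (2 * n) (g @ g) c = word_act (2 * n) [] c"
    using assms by (intro word_act_cong) (auto simp: twisted_gen_invol)
  then show ?thesis by simp
qed

section \<open>Charges and descent to the empty core\<close>

text \<open>Beads of a core in the residue class of \<open>x\<close> form a ray \<open>{x + m q | q < N x}\<close>. The charge \<open>N\<close> is kept as
a function on all integers, not only on residues: then permutations of positions act on it by plain
composition.\<close>

definition is_charge :: "int \<Rightarrow> int set \<Rightarrow> (int \<Rightarrow> int) \<Rightarrow> bool" where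
  "is_charge m B N \<longleftrightarrow> (\<forall>x q. x + m * q \<in> B \<longleftrightarrow> q < N x)"

lemma threshold_exists:
  fixes P :: "int \<Rightarrow> bool"
  assumes down: "\<And>q. P (q + 1) \<Longrightarrow> P q" and "P a" "\<not> P b"
  shows "\<exists>t. \<forall>q. P q \<longleftrightarrow> q < t"
proof -
  have mono: "P (q - int k)" if "P q" for q k
    by (induction k) (use that down[of "q - int _ - 1"] in \<open>auto simp: algebra_simps\<close>)
  have mono': "P q'" if "P q" "q' \<le> q" for q q'
    using mono[OF that(1), of "nat (q - q')"] that(2) by simp
  have "a < b" using mono' assms(2,3) by (meson linorder_not_le)
  then have "\<not> P (a + int (nat (b - a)))" using assms(3) by simp
  then have ex: "\<exists>k. \<not> P (a + int k)" ..
  define k where "k = (LEAST k. \<not> P (a + int k))"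
  have k: "\<not> P (a + int k)" unfolding k_def using ex by (rule LeastI_ex)
  have "P q" if "q < a + int k" for q
  proof (cases "q \<le> a")
    case True
    then show ?thesis using mono'[OF assms(2)] by simp
  next
    case False
    then have "nat (q - a) < k" using that by simp
    then have "P (a + int (nat (q - a)))" unfolding k_def using not_less_Least by blast
    then show ?thesis using False by simp
  qed
  moreover have "q < a + int k" if "P q" for q
    using mono'[OF that, of "a + int k"] k by force
  ultimately show ?thesis by blast
qed

lemma core_has_charge:
  assumes "c \<in> cores m" "m > 0"
  obtains N where "is_charge (int m) (beads c) N"
proof -
  have c: "is_partition c" and core: "\<And>x. x \<in> beads c \<Longrightarrow> x - int m \<in> beads c"
    using assms cores_iff by auto
  obtain L U where L: "\<And>z. z \<le> L \<Longrightarrow> z \<in> beads c" and U: "\<And>z. U < z \<Longrightarrow> z \<notin> beads c"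
    using beads_bounded[OF c] by metis
  have "\<exists>t. \<forall>q. x + int m * q \<in> beads c \<longleftrightarrow> q < t" for x
  proof (rule threshold_exists)
    show "x + int m * q \<in> beads c" if "x + int m * (q + 1) \<in> beads c" for q
      using core[OF that] by (simp add: algebra_simps)
    have scale: "\<bar>d\<bar> \<le> int m * \<bar>d\<bar>" for d using assms(2) mult_right_mono[of 1 "int m" "\<bar>d\<bar>"] by simp
    show "x + int m * (- \<bar>L - x\<bar>) \<in> beads c"
      by (rule L) (use scale[of "L - x"] in simp)
    show "x + int m * \<bar>U - x + 1\<bar> \<notin> beads c"
      by (rule U) (use scale[of "U - x + 1"] in simp)
  qed
  then obtain N where "\<forall>x q. x + int m * q \<in> beads c \<longleftrightarrow> q < N x" by metis
  then have "is_charge (int m) (beads c) N" unfolding is_charge_def .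
  then show ?thesis by (rule that)
qed

lemma charge_shift:
  assumes "is_charge m B N"
  shows "N (x - m) = N x + 1"
proof -
  have "q < N (x - m) \<longleftrightarrow> q < N x + 1" for q
  proof -
    have "x - m + m * q = x + m * (q - 1)" by (simp add: algebra_simps)
    then have "q < N (x - m) \<longleftrightarrow> q - 1 < N x" using assms unfolding is_charge_def by metis
    then show ?thesis by linarith
  qed
  then show ?thesis by (metis linorder_neqE less_irrefl)
qed

lemma charge_reflect:
  assumes "is_charge m B N" and sym: "\<And>x. x \<in> B \<longleftrightarrow> 1 - x \<notin> B"
  shows "N (1 - x) = 1 - N x"
proof -
  have "q < N (1 - x) \<longleftrightarrow> q < 1 - N x" for q
  proof -
    have "1 - (x + m * (- q)) = 1 - x + m * q" by simp
    then have "q < N (1 - x) \<longleftrightarrow> \<not> (- q < N x)"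
      using assms(1) sym[of "1 - x + m * q"] unfolding is_charge_def
      by (metis diff_diff_eq2 add_diff_cancel_left' diff_add_cancel)
    then show ?thesis by linarith
  qed
  then show ?thesis by (metis linorder_neqE less_irrefl)
qed

lemma charge_word_perm:
  assumes "is_charge (int m) B N"
  shows "is_charge (int m) (word_perm m w -` B) (N \<circ> word_perm m w)"
  using assms by (simp add: is_charge_def word_perm_shift)

text \<open>For the charge of a self-conjugate \<open>2 n\<close>-core this is its number of boxes: a positive bead \<open>x\<close> of a
self-conjugate partition accounts for a diagonal hook with \<open>2 x - 1\<close> boxes, and the sum of these over
the beads in the residue classes of \<open>r\<close> and \<open>1 - r\<close> is the summand for \<open>r\<close>.\<close>

definition charge_size :: "nat \<Rightarrow> (int \<Rightarrow> int) \<Rightarrow> int" where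
  "charge_size n N =
    (\<Sum>r\<in>{1..int n}. 2 * int n * (N r)\<^sup>2 - (2 * int n + 1 - 2 * r) * N r)"

lemma charge_size_nonneg: "0 \<le> charge_size n N"
  unfolding charge_size_def
proof (rule sum_nonneg)
  fix r assume r: "r \<in> {1..int n}"
  have sq: "N r \<le> (N r)\<^sup>2" "- N r \<le> (N r)\<^sup>2"
    using self_le_power[of "\<bar>N r\<bar>" 2] by (cases "N r = 0"; simp; linarith)+
  show "0 \<le> 2 * int n * (N r)\<^sup>2 - (2 * int n + 1 - 2 * r) * N r"
  proof (cases "N r \<ge> 0")
    case True
    have "(2 * int n + 1 - 2 * r) * N r \<le> 2 * int n * N r"
      using r True by (intro mult_right_mono) auto
    also have "\<dots> \<le> 2 * int n * (N r)\<^sup>2" using sq(1) by (intro mult_left_mono) auto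
    finally show ?thesis by simp
  next
    case False
    then have "(2 * int n + 1 - 2 * r) * N r \<le> 0" using r by (intro mult_nonneg_nonpos) auto
    moreover have "0 \<le> 2 * int n * (N r)\<^sup>2" by simp
    ultimately show ?thesis by linarith
  qed
qed

text \<open>A generator alters at most two of the coordinates \<open>N 1, ..., N n\<close>, so only these enter the difference.\<close>

lemma charge_size_change:
  assumes "A \<subseteq> {1..int n}" "\<And>r. r \<in> {1..int n} - A \<Longrightarrow> N' r = N r"
  shows "charge_size n N' - charge_size n N =
    (\<Sum>r\<in>A. 2 * int n * ((N' r)\<^sup>2 - (N r)\<^sup>2) - (2 * int n + 1 - 2 * r) * (N' r - N r))"
proof -
  have "charge_size n N' - charge_size n N = (\<Sum>r\<in>{1..int n}.
      2 * int n * ((N' r)\<^sup>2 - (N r)\<^sup>2) - (2 * int n + 1 - 2 * r) * (N' r - N r))"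
    unfolding charge_size_def sum_subtractf[symmetric] by (simp add: algebra_simps)
  also have "\<dots> = (\<Sum>r\<in>A. 2 * int n * ((N' r)\<^sup>2 - (N r)\<^sup>2) - (2 * int n + 1 - 2 * r) * (N' r - N r))"
    using assms by (intro sum.mono_neutral_right) auto
  finally show ?thesis .
qed

text \<open>The two symmetries that the charge of a self-conjugate \<open>2 n\<close>-core has. They reduce all values to those
on \<open>{1..n}\<close>.\<close>

locale self_conjugate_charge =
  fixes n :: nat and N :: "int \<Rightarrow> int"
  assumes n: "n \<ge> 3"
    and shift: "\<And>x. N (x - 2 * int n) = N x + 1"
    and reflect: "\<And>x. N (1 - x) = 1 - N x"
begin

lemma not_dvd_small: "0 < \<bar>d\<bar> \<Longrightarrow> \<bar>d\<bar> < 2 * int n \<Longrightarrow> \<not> 2 * int n dvd d"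
  using dvd_imp_le_int[of d "2 * int n"] by auto

text \<open>The coordinates \<open>i\<close> and \<open>i + 1\<close> are exchanged; their linear coefficients differ by 2.\<close>

lemma size_change_pair:
  assumes "1 \<le> i" "i < n"
  shows "charge_size n (N \<circ> word_perm (2 * n) [i, 2 * n - i]) =
    charge_size n N + 2 * (N (int i) - N (int i + 1))"
proof -
  let ?m = "2 * int n" and ?p = "word_perm (2 * n) [i, 2 * n - i]"
  have p: "?p x = adj_swap ?m (- int i) (adj_swap ?m (int i) x)" for x
    using adj_swap_complement[of i n] assms by (simp del: of_nat_diff)
  have other: "adj_swap ?m (- int i) x = x" if "1 \<le> x" "x \<le> int n" for x
    using that assms not_dvd_small[of "x + int i"] not_dvd_small[of "x + int i - 1"]
    by (intro adj_swap_fix) auto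
  have pi: "?p (int i) = int i + 1" "?p (int i + 1) = int i"
    using adj_swap_up[of ?m "int i" "int i"] adj_swap_down[of ?m "int i + 1" "int i"]
      other[of "int i"] other[of "int i + 1"] assms by (simp_all only: p) simp_all
  have pr: "?p r = r" if "r \<in> {1..int n} - {int i, int i + 1}" for r
  proof -
    have "adj_swap ?m (int i) r = r"
      using that assms by (intro adj_swap_fix not_dvd_small) auto
    then show ?thesis using that other[of r] by (simp only: p) simp
  qed
  have "charge_size n (N \<circ> ?p) - charge_size n N = 2 * (N (int i) - N (int i + 1))"
    using assms pi pr
    by (subst charge_size_change[of "{int i, int i + 1}"]) (simp_all add: algebra_simps)
  then show ?thesis by simp
qed

text \<open>The last coordinate is negated: position \<open>n + 1\<close> lies in the class of \<open>1 - n\<close>, the mirror image of \<open>n\<close>.\<close>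

lemma size_change_last:
  "charge_size n (N \<circ> word_perm (2 * n) [n]) = charge_size n N + 2 * N (int n)"
proof -
  let ?m = "2 * int n" and ?p = "word_perm (2 * n) [n]"
  have "?p (int n) = int n + 1" using adj_swap_up[of ?m "int n" "int n"] by simp
  then have pn: "N (?p (int n)) = - N (int n)"
    using shift[of "int n + 1"] reflect[of "int n"] by simp
  have pr: "?p r = r" if "r \<in> {1..int n} - {int n}" for r
  proof -
    have "adj_swap ?m (int n) r = r"
      using that not_dvd_small[of "r - int n"] not_dvd_small[of "r - int n - 1"]
      by (intro adj_swap_fix) auto
    then show ?thesis by simp
  qed
  have "charge_size n (N \<circ> ?p) - charge_size n N = 2 * N (int n)"
    using n pn pr by (subst charge_size_change[of "{int n}"]) (simp_all add: algebra_simps)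
  then show ?thesis by simp
qed

text \<open>The pair of the first two coordinates \<open>(a, b)\<close> becomes \<open>(1 - b, 1 - a)\<close>.\<close>

lemma size_change_zero:
  "charge_size n (N \<circ> word_perm (2 * n) [0, 1, 2 * n - 1, 0]) =
    charge_size n N + 4 * (1 - N 1 - N 2)"
proof -
  define p where "p = word_perm (2 * n) [0, 1, 2 * n - 1, 0]"
  have "p 1 = - 1" "p 2 = 0"
    using twisted_gen_zero_value(3,4)[OF n, of 0] by (simp_all add: p_def)
  then have pv: "N (p 1) = 1 - N 2" "N (p 2) = 1 - N 1"
    using reflect[of 1] reflect[of 2] by simp_all
  have pr: "p r = r" if "r \<in> {1..int n} - {1, 2}" for r
    unfolding p_def
    using that n not_dvd_small[of "r + 1"] not_dvd_small[of r]
      not_dvd_small[of "r - 1"] not_dvd_small[of "r - 2"]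
    by (intro twisted_gen_zero_fix) auto
  have "charge_size n (N \<circ> p) - charge_size n N = (\<Sum>r\<in>{1, 2}.
      2 * int n * (((N \<circ> p) r)\<^sup>2 - (N r)\<^sup>2) - (2 * int n + 1 - 2 * r) * ((N \<circ> p) r - N r))"
    by (rule charge_size_change) (use n pr in auto)
  also have "\<dots> = 4 * (1 - N 1 - N 2)"
    by (simp add: pv) (simp add: algebra_simps power2_eq_square)
  finally show ?thesis by (simp add: p_def)
qed

text \<open>Minimality under all generators puts the coordinates into the fundamental alcove
\<open>N 1 \<ge> ... \<ge> N n \<ge> 0\<close>, \<open>N 1 + N 2 \<le> 1\<close>, whose only integer points are 0 and the first unit vector.\<close>

lemma positive_beads_of_minimal:
  assumes min: "\<And>g. g \<in> twisted_gens n \<Longrightarrow>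
      charge_size n N \<le> charge_size n (N \<circ> word_perm (2 * n) g)"
    and x: "0 < x" and q: "0 < N x"
  shows "x = 1"
proof -
  have dec: "N (int i + 1) \<le> N (int i)" if "1 \<le> i" "i < n" for i
  proof -
    have "[i, 2 * n - i] \<in> twisted_gens n" using that by (auto simp: twisted_gens_def)
    from min[OF this] show ?thesis using size_change_pair[OF that] by simp
  qed
  have "[n] \<in> twisted_gens n" by (simp add: twisted_gens_def)
  from min[OF this] have last: "0 \<le> N (int n)" using size_change_last by simp
  have "[0, 1, 2 * n - 1, 0] \<in> twisted_gens n" by (simp add: twisted_gens_def)
  from min[OF this] have sum: "N 1 + N 2 \<le> 1" using size_change_zero by simp
  have anti: "N (int b) \<le> N (int a)" if "1 \<le> a" "a \<le> b" "b \<le> n" for a b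
    using that(2,1,3)
  proof (induction b rule: dec_induct)
    case (step b)
    then show ?case using dec[of b] by (simp add: add.commute)
  qed simp
  have nonneg: "0 \<le> N (int r)" if "1 \<le> r" "r \<le> n" for r
    using anti[of r n] that last by simp
  have "N 2 \<le> N 1" using anti[of 1 2] n by simp
  then have N2: "N 2 = 0" and N1: "N 1 \<le> 1" using sum nonneg[of 1] nonneg[of 2] n by auto
  let ?m = "2 * int n"
  \<comment> \<open>Representatives of the residue classes are taken in \<open>1, ..., 2 n\<close>, hence the shift by one.\<close>
  define k where "k = (x - 1) div ?m"
  define r where "r = (x - 1) mod ?m + 1"
  have xr: "x = r + ?m * k" unfolding k_def r_def by (simp add: mult.commute)
  have r: "1 \<le> r" "r \<le> ?m" unfolding r_def
    using n pos_mod_bound[of ?m "x - 1"] pos_mod_sign[of ?m "x - 1"] by linarith+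
  have k: "0 \<le> k" unfolding k_def using x n by (simp add: pos_imp_zdiv_nonneg_iff)
  have "N (y + ?m * int j) = N y - int j" for y j
  proof (induction j)
    case (Suc j)
    then show ?case using shift[of "y + ?m * int (Suc j)"] by (simp add: algebra_simps)
  qed simp
  from this[of r "nat k"] have kN: "k < N r" using q k xr by simp
  have "r = 1"
  proof (rule ccontr)
    assume "r \<noteq> 1"
    show False
    proof (cases "r \<le> int n")
      case True
      have "N (int (nat r)) \<le> N (int 2)" using True \<open>r \<noteq> 1\<close> r by (intro anti) auto
      then show False using kN k N2 r by simp
    next
      case False
      have "N r = - N (?m + 1 - r)"
        using shift[of r] reflect[of "?m + 1 - r"] by simp
      moreover have "0 \<le> N (int (nat (?m + 1 - r)))" using False r by (intro nonneg) auto
      ultimately show False using kN k r by simp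
    qed
  qed
  then show "x = 1" using kN k N1 xr by simp
qed

end

text \<open>Descent: a generator that lowers \<open>charge_size\<close> leads to a smaller core, and being an involution it
also leads back. A core that no generator lowers has no positive bead other than possibly 1; the
parity of the diagonal excludes 1, and symmetry then makes it the empty core.\<close>

lemma sc_even_core_reachable:
  assumes "n \<ge> 3" "c \<in> sc_even_cores (2 * n)" "is_charge (2 * int n) (beads c) N"
  shows "\<exists>ws\<in>lists (twisted_gens n). c = word_act (2 * n) (concat ws) {}"
  using assms(2,3)
proof (induction "nat (charge_size n N)" arbitrary: c N rule: less_induct)
  case less
  have c: "c \<in> cores (2 * n)" and sym: "\<And>x. x \<in> beads c \<longleftrightarrow> 1 - x \<notin> beads c"
    and par: "even (card {x \<in> beads c. 0 < x})"
    using less.prems(1) unfolding mem_sc_even_cores_iff by blast+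
  have part: "is_partition c" using c by (simp add: cores_def)
  interpret self_conjugate_charge n N
    by unfold_locales
      (use assms(1) charge_shift[OF less.prems(2)] charge_reflect[OF less.prems(2) sym] in auto)
  show ?case
  proof (cases "\<exists>g\<in>twisted_gens n. charge_size n (N \<circ> word_perm (2 * n) g) < charge_size n N")
    case True
    then obtain g where g: "g \<in> twisted_gens n"
      and lt: "charge_size n (N \<circ> word_perm (2 * n) g) < charge_size n N" by blast
    have gl: "g \<in> lists {..<2 * n}" using twisted_gens_lists[OF n] g by blast
    have "nat (charge_size n (N \<circ> word_perm (2 * n) g)) < nat (charge_size n N)"
      using lt charge_size_nonneg[of n "N \<circ> word_perm (2 * n) g"] by linarith
    moreover have "is_charge (2 * int n) (beads (word_act (2 * n) g c)) (N \<circ> word_perm (2 * n) g)"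
      using charge_word_perm[of "2 * n" "beads c" N g] less.prems(2) beads_word_act[OF _ gl c] n
      by simp
    ultimately obtain ws where ws: "ws \<in> lists (twisted_gens n)"
      "word_act (2 * n) g c = word_act (2 * n) (concat ws) {}"
      using less.hyps word_act_sc_even_core[OF n g less.prems(1)] by blast
    have "c = word_act (2 * n) (concat (g # ws)) {}"
      using word_act_twisted_gen_invol[OF n g c] ws(2) by simp
    moreover have "g # ws \<in> lists (twisted_gens n)" using g ws(1) by simp
    ultimately show ?thesis by blast
  next
    case False
    have "x = 1" if "x \<in> beads c" "0 < x" for x
    proof (rule positive_beads_of_minimal)
      show "0 < N x" using less.prems(2) that(1) unfolding is_charge_def
        by (metis add.right_neutral mult_zero_right)
    qed (use False that in \<open>auto simp: not_less\<close>)
    then have sub: "{x \<in> beads c. 0 < x} \<subseteq> {1}" by auto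
    have "{x \<in> beads c. 0 < x} \<noteq> {1}"
    proof
      assume "{x \<in> beads c. 0 < x} = {1}"
      with par have "even (card {1 :: int})" by (simp only:)
      then show False by simp
    qed
    with sub have none: "{x \<in> beads c. 0 < x} = {}" by blast
    have "beads c = {..0}"
    proof (rule Set.set_eqI)
      fix x
      show "x \<in> beads c \<longleftrightarrow> x \<in> {..0}"
        using none sym[of x] by (cases "0 < x") auto
    qed
    then have "c = {}" using beads_inject[OF part partition_empty] beads_empty by simp
    then show ?thesis by (intro bexI[of _ "[]"]) auto
  qed
qed

theorem lemma5p10:
  fixes n :: nat
  assumes "n \<ge> 3"
  shows "orbit (affine_weyl_A (2 * n)\<lparr>carrier := twisted_weyl_A n\<rparr>) (core_action (2 * n)) {}
           = sc_even_cores (2 * n)"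
proof -
  have "word_act (2 * n) (concat ws) {} \<in> sc_even_cores (2 * n)"
    if "ws \<in> lists (twisted_gens n)" for ws
    using that
  proof (induction ws)
    case Nil
    have "card {x :: int. x \<le> 0 \<and> 0 < x} = 0" by (rule card_eq_0_iff[THEN iffD2]) auto
    then show ?case
      using assms by (auto simp: mem_sc_even_cores_iff beads_empty empty_core simp del: Collect_empty_eq)
  next
    case (Cons g ws)
    then show ?case using word_act_sc_even_core[OF assms] by simp
  qed
  moreover have "c \<in> (\<lambda>ws. word_act (2 * n) (concat ws) {}) ` lists (twisted_gens n)"
    if c: "c \<in> sc_even_cores (2 * n)" for c
  proof -
    have "c \<in> cores (2 * n)" using c by (simp add: sc_even_cores_def)
    then obtain N where "is_charge (int (2 * n)) (beads c) N"
      by (rule core_has_charge) (use assms in simp)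
    then show ?thesis using sc_even_core_reachable[OF assms c, of N] by auto
  qed
  ultimately show ?thesis unfolding orbit_empty_eq[OF assms] by blast
qed

end
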